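(* Let $s\in\mathrm{Spin}(m)$ and let $f=f(\xi_1,\dots,\xi_m)$ be a discrete harmonic function, i.e. $\Delta f=0$. Then $H^1(s)f$ and $H^0(s)f$ are discrete harmonic functions, where $H^0(s)f(\xi_1,\dots,\xi_m)=f(\bar s\,\xi\,s)$ and $H^1(s)f(\xi_1,\dots,\xi_m)=s\,f(\bar s\,\xi\,s)\,\bar s$.
   Context: Clifford algebra: $\mathbb{C}_{2m,0}$ is the complex Clifford algebra generated by $\mathbf{e}_j^{\pm}$, $j=1,\dots,m$, with $\{\mathbf{e}_j^+,\mathbf{e}_k^+\}=\{\mathbf{e}_j^-,\mathbf{e}_k^-\}=0$, $\{\mathbf{e}_j^+,\mathbf{e}_k^-\}=\delta_{jk}$ ($\{a,b\}=ab+ba$); $e_j=\mathbf{e}_j^++\mathbf{e}_j^-$. Discrete functions are functions $f:\mathbb{Z}^m\to\mathbb{C}_{2m,0}$. With $\Delta_j^+f(x)=f(x+e_j)-f(x)$, $\Delta_j^-f(x)=f(x)-f(x-e_j)$ (in the argument $e_j$ denotes the $j$-th unit lattice vector), put $\partial_j=\mathbf{e}_j^+\Delta_j^++\mathbf{e}_j^-\Delta_j^-$, $\partial=\sum_j\partial_j$ (discrete Dirac operator); $\Delta=\partial^2$ is the star Laplacian $\Delta f(x)=\sum_j\big(f(x+e_j)+f(x-e_j)-2f(x)\big)$. Basic polynomials: for $\alpha\in\mathbb{N}^m$, $\xi^\alpha[1]=\xi_1^{\alpha_1}\cdots\xi_m^{\alpha_m}[1]$ is the discrete function determined by $\xi^0[1]=1$,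 $\partial_j\,\xi^\alpha[1]=(-1)^{\alpha_1+\dots+\alpha_{j-1}}\alpha_j\,\xi^{\alpha-\epsilon_j}[1]$ ($\epsilon_j$ the $j$-th unit multi-index) and $\xi^\alpha[1](0)=0$ for $\alpha\ne0$; one has $\xi^\alpha[1](x)=0$ as soon as some $\alpha_j\ge 2|x_j|+1$. Every discrete function has a unique, pointwise finite Taylor expansion $f=\sum_\alpha\xi^\alpha[1]\,c_\alpha$, $c_\alpha\in\mathbb{C}_{2m,0}$; discrete polynomials are finite such sums. The right $\mathbb{C}_{2m,0}$-linear operators $\xi_j,R_j$ (extended termwise to Taylor series) are given by $\xi_j(\xi^\alpha[1])=(-1)^{\alpha_1+\dots+\alpha_{j-1}}\xi^{\alpha+\epsilon_j}[1]$ and $R_j(\xi^\alpha[1])=(-1)^{|\alpha|-\alpha_j}\xi^\alpha[1]\,e_j$. They satisfy $\{\xi_j,\xi_k\}=\{\partial_j,\partial_k\}=\{\partial_j,\xi_k\}=0$ ($j\neq k$), $\partial_j\xi_j-\xi_j\partial_j=1$, $\{R_j,R_k\}=2\delta_{jk}$, $R_j[1]=e_j$, $\{R_j,\xi_k\}=2R_j\xi_j\delta_{jk}$, $\{R_j,\partial_k\}=2R_j\partial_j\delta_{jk}$. Put $\xi=\sum_j\xi_j$ and $\langle X,Y\rangle=\frac12(XY+YX)$ for operators $X,Y$. Spin group: $\mathbb{R}^1_m=\{\sum_j\omega_jR_j:\omega_j\in\mathbb{R}\}$, $S^{m-1}=\{\underline\omega\in\mathbb{R}^1_m:\underline\omega^2=1\}$;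 $\mathrm{Spin}(m)$ is the group of products of an even number of elements of $S^{m-1}$. The conjugation satisfies $\overline{R_j}=-R_j$, $\overline{ab}=\bar b\,\bar a$, so $\bar s=s^{-1}$ for $s\in\mathrm{Spin}(m)$. Substitution: for $s\in\mathrm{Spin}(m)$ let $\eta=\bar s\,\xi\,s$ and $\eta_j=\langle\eta,R_j\rangle R_j$, so $\eta=\sum_j\eta_j$. For $f=\sum_\alpha\xi^\alpha[1]c_\alpha$, $f(\bar s\,\xi\,s)=\sum_\alpha\eta_1^{\alpha_1}\cdots\eta_m^{\alpha_m}[1]\,c_\alpha$. In $H^1$, the factor $s$ on the left acts as an operator and the factor $\bar s$ on the right is right multiplication by the constant $\bar s[1]\in\mathbb{C}_{2m,0}$. *)

theory Defs
  imports "HOL-Analysis.Analysis" "HOL-Library.Groups_Big_Fun"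
begin

section \<open>The complex Clifford algebra\<close>

text \<open>
  The index set \<open>{1,\<dots>,m}\<close> is a finite linearly ordered type \<open>'m\<close>. The algebra is realised on the basis
  of ordered products \<open>e\<^sub>A\<close> of \<open>2m\<close> anticommuting generators of square \<open>+1\<close>, indexed by \<open>'m + 'm\<close>,
  and an element is stored as its coordinate function. The generators \<open>e\<^sub>j\<^sup>+\<close>, \<open>e\<^sub>j\<^sup>-\<close> are
  recovered below as \<open>(g\<^sub>j \<mp> i g\<^sub>j') / 2\<close>; conversely \<open>g\<^sub>j = e\<^sub>j\<^sup>+ + e\<^sub>j\<^sup>-\<close> and
  \<open>g\<^sub>j' = i (e\<^sub>j\<^sup>+ - e\<^sub>j\<^sup>-)\<close>.
\<close>

typedef 'm clifford = "UNIV :: (('m + 'm) set \<Rightarrow> complex) set"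
  morphisms coord Clifford ..

setup_lifting type_definition_clifford

fun gen_less :: "'m::linorder + 'm \<Rightarrow> 'm + 'm \<Rightarrow> bool" where
  "gen_less (Inl i) (Inl j) = (i < j)"
| "gen_less (Inl i) (Inr j) = True"
| "gen_less (Inr i) (Inl j) = False"
| "gen_less (Inr i) (Inr j) = (i < j)"

text \<open>
  \<open>e\<^sub>A e\<^sub>B = reorder_sign A B \<cdot> e\<^sub>C\<close> with \<open>C\<close> the symmetric difference of \<open>A\<close> and \<open>B\<close>: the exponent
  counts the transpositions that sort the concatenated product.
\<close>

definition reorder_sign :: "('m::linorder + 'm) set \<Rightarrow> ('m + 'm) set \<Rightarrow> complex" where
  "reorder_sign A B = (-1) ^ card {(a, b). a \<in> A \<and> b \<in> B \<and> gen_less b a}"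

lemma reorder_sign_prod:
  fixes A B :: "('m::{finite,linorder} + 'm) set"
  shows "reorder_sign A B = (\<Prod>a\<in>A. \<Prod>b\<in>B. if gen_less b a then -1 else 1)"
proof -
  have "(\<Prod>a\<in>A. \<Prod>b\<in>B. if gen_less b a then -1 else (1::complex)) =
        (\<Prod>p\<in>A \<times> B. if gen_less (snd p) (fst p) then -1 else 1)"
    by (simp add: prod.cartesian_product case_prod_beta)
  also have "\<dots> = (\<Prod>p\<in>{p \<in> A \<times> B. gen_less (snd p) (fst p)}. -1)"
    by (subst prod.inter_filter) auto
  also have "\<dots> = reorder_sign A B"
    by (simp add: reorder_sign_def, rule arg_cong[where f = "\<lambda>S. (-1) ^ card S"]) auto
  finally show ?thesis by simp
qed

lemma prod_sym_diff:
  fixes f :: "'a::finite \<Rightarrow> complex"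
  assumes "\<And>a. f a * f a = 1"
  shows "prod f (sym_diff A B) = prod f A * prod f B"
proof -
  have AB: "prod f A = prod f (A - B) * prod f (A \<inter> B)"
           "prod f B = prod f (B - A) * prod f (A \<inter> B)"
    using prod.Int_Diff[of A f B] prod.Int_Diff[of B f A] by (simp_all add: Int_commute mult.commute)
  have "prod f (A \<inter> B) * prod f (A \<inter> B) = 1"
    by (simp add: assms flip: prod.distrib)
  moreover have "prod f (sym_diff A B) = prod f (A - B) * prod f (B - A)"
    by (rule prod.union_disjoint) auto
  ultimately show ?thesis by (simp add: AB algebra_simps)
qed

lemma reorder_sign_sym_diff:
  fixes A B C :: "('m::{finite,linorder} + 'm) set"
  shows "reorder_sign (sym_diff A B) C = reorder_sign A C * reorder_sign B C"
    and "reorder_sign A (sym_diff B C) = reorder_sign A B * reorder_sign A C"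
proof -
  show "reorder_sign (sym_diff A B) C = reorder_sign A C * reorder_sign B C"
    unfolding reorder_sign_prod by (rule prod_sym_diff) (simp add: if_distrib cong: if_cong flip: prod.distrib)
  show "reorder_sign A (sym_diff B C) = reorder_sign A B * reorder_sign A C"
    unfolding reorder_sign_prod by (subst prod_sym_diff) (auto simp: prod.distrib)
qed

lemma reorder_sign_empty [simp]: "reorder_sign {} B = 1" "reorder_sign A {} = 1"
  by (simp_all add: reorder_sign_def)

instantiation clifford :: (type) real_vector
begin
lift_definition zero_clifford :: "'a clifford" is "\<lambda>_. 0" .
lift_definition plus_clifford :: "'a clifford \<Rightarrow> 'a clifford \<Rightarrow> 'a clifford" is "\<lambda>x y A. x A + y A" .
lift_definition minus_clifford :: "'a clifford \<Rightarrow> 'a clifford \<Rightarrow> 'a clifford" is "\<lambda>x y A. x A - y A" .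
lift_definition uminus_clifford :: "'a clifford \<Rightarrow> 'a clifford" is "\<lambda>x A. - x A" .
lift_definition scaleR_clifford :: "real \<Rightarrow> 'a clifford \<Rightarrow> 'a clifford" is "\<lambda>r x A. r *\<^sub>R x A" .
instance
  by standard (transfer; simp add: fun_eq_iff algebra_simps)+
end

lemma sum_sym_diff_shift:
  fixes f :: "'a::finite set \<Rightarrow> 'b::comm_monoid_add"
  shows "(\<Sum>A\<in>UNIV. f (sym_diff B A)) = (\<Sum>A\<in>UNIV. f A)"
  by (rule sum.reindex_bij_witness[of _ "sym_diff B" "sym_diff B"]) auto

instantiation clifford :: ("{finite,linorder}") real_algebra_1
begin
lift_definition one_clifford :: "'a clifford" is "\<lambda>A. if A = {} then 1 else 0" .
lift_definition times_clifford :: "'a clifford \<Rightarrow> 'a clifford \<Rightarrow> 'a clifford" is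
  "\<lambda>x y C. \<Sum>A\<in>UNIV. reorder_sign A (sym_diff A C) * x A * y (sym_diff A C)" .
instance
proof
  fix x y z :: "'a clifford" and r :: real
  show "x * y * z = x * (y * z)"
  proof (transfer, rule ext)
    fix x y z :: "('a + 'a) set \<Rightarrow> complex" and D :: "('a + 'a) set"
    have "(\<Sum>A\<in>UNIV. reorder_sign A (sym_diff A D) *
             (\<Sum>B\<in>UNIV. reorder_sign B (sym_diff B A) * x B * y (sym_diff B A)) * z (sym_diff A D)) =
          (\<Sum>B\<in>UNIV. \<Sum>A\<in>UNIV. reorder_sign A (sym_diff A D) * reorder_sign B (sym_diff B A) *
             x B * y (sym_diff B A) * z (sym_diff A D))"
      by (subst sum.swap) (simp add: sum_distrib_left sum_distrib_right mult_ac)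
    also have "\<dots> = (\<Sum>B\<in>UNIV. \<Sum>A\<in>UNIV. reorder_sign B (sym_diff B D) * x B *
        (reorder_sign A (sym_diff A (sym_diff B D)) * y A * z (sym_diff A (sym_diff B D))))"
    proof (rule sum.cong[OF refl])
      fix B :: "('a + 'a) set"
      let ?f = "\<lambda>A. reorder_sign A (sym_diff A D) * reorder_sign B (sym_diff B A) *
             x B * y (sym_diff B A) * z (sym_diff A D)"
      have "(\<Sum>A\<in>UNIV. ?f A) = (\<Sum>A\<in>UNIV. ?f (sym_diff B A))"
        by (rule sum_sym_diff_shift[symmetric])
      also have "\<dots> = (\<Sum>A\<in>UNIV. reorder_sign B (sym_diff B D) * x B *
        (reorder_sign A (sym_diff A (sym_diff B D)) * y A * z (sym_diff A (sym_diff B D))))"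
      proof (rule sum.cong[OF refl])
        fix A :: "('a + 'a) set"
        define C where "C = sym_diff A (sym_diff B D)"
        have s: "sym_diff (sym_diff B A) D = C" "sym_diff B (sym_diff B A) = A" "sym_diff B D = sym_diff A C"
          unfolding C_def by blast+
        show "?f (sym_diff B A) = reorder_sign B (sym_diff B D) * x B *
            (reorder_sign A (sym_diff A (sym_diff B D)) * y A * z (sym_diff A (sym_diff B D)))"
          unfolding s(1,2) C_def[symmetric] unfolding s(3) reorder_sign_sym_diff
          by (simp add: mult_ac)
      qed
      finally show "(\<Sum>A\<in>UNIV. ?f A) = (\<Sum>A\<in>UNIV. reorder_sign B (sym_diff B D) * x B *
        (reorder_sign A (sym_diff A (sym_diff B D)) * y A * z (sym_diff A (sym_diff B D))))" .
    qed
    finally show "(\<Sum>A\<in>UNIV. reorder_sign A (sym_diff A D) *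
             (\<Sum>B\<in>UNIV. reorder_sign B (sym_diff B A) * x B * y (sym_diff B A)) * z (sym_diff A D)) =
         (\<Sum>A\<in>UNIV. reorder_sign A (sym_diff A D) * x A *
             (\<Sum>B\<in>UNIV. reorder_sign B (sym_diff B (sym_diff A D)) * y B * z (sym_diff B (sym_diff A D))))"
      by (simp add: sum_distrib_left)
  qed
  show "1 * x = x"
    by (transfer, rule ext) (simp add: if_distrib if_distribR sum.delta cong: if_cong)
  show "x * 1 = x"
  proof (transfer, rule ext)
    fix x :: "('a + 'a) set \<Rightarrow> complex" and C
    have "sym_diff A C = {} \<longleftrightarrow> A = C" for A :: "('a + 'a) set" by blast
    then show "(\<Sum>A\<in>UNIV. reorder_sign A (sym_diff A C) * x A * (if sym_diff A C = {} then 1 else 0)) = x C"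
      by (simp add: if_distrib if_distribR sum.delta cong: if_cong)
  qed
  show "(x + y) * z = x * z + y * z" "x * (y + z) = x * y + x * z"
    by (transfer, simp add: algebra_simps sum.distrib)+
  show "r *\<^sub>R x * y = r *\<^sub>R (x * y)" "x * r *\<^sub>R y = r *\<^sub>R (x * y)"
    by (transfer, simp add: scaleR_sum_right)+
  show "(0::'a clifford) \<noteq> 1"
    by transfer (metis one_neq_zero)
qed
end

definition gen :: "'m + 'm \<Rightarrow> 'm clifford" where
  "gen g = Clifford (\<lambda>A. if A = {g} then 1 else 0)"

definition complex_unit :: "'m clifford" where
  "complex_unit = Clifford (\<lambda>A. if A = {} then \<i> else 0)"

definition ep :: "'m::{finite,linorder} \<Rightarrow> 'm clifford" where
  "ep j = (1/2) *\<^sub>R (gen (Inl j) - complex_unit * gen (Inr j))"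

definition em :: "'m::{finite,linorder} \<Rightarrow> 'm clifford" where
  "em j = (1/2) *\<^sub>R (gen (Inl j) + complex_unit * gen (Inr j))"

lemma blade_mult:
  fixes A B :: "('m::{finite,linorder} + 'm) set"
  shows "Clifford (\<lambda>X. if X = A then c else 0) * Clifford (\<lambda>X. if X = B then d else 0) =
    Clifford (\<lambda>X. if X = sym_diff A B then reorder_sign A B * c * d else 0)"
proof -
  have "(\<Sum>Y\<in>UNIV. reorder_sign Y (sym_diff Y X) * (if Y = A then c else 0) *
      (if sym_diff Y X = B then d else 0)) = (if X = sym_diff A B then reorder_sign A B * c * d else 0)" for X
  proof -
    have eq: "sym_diff A X = B \<longleftrightarrow> X = sym_diff A B" by blast
    have "(\<Sum>Y\<in>UNIV. reorder_sign Y (sym_diff Y X) * (if Y = A then c else 0) *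
      (if sym_diff Y X = B then d else 0)) =
      (\<Sum>Y\<in>UNIV. if Y = A then reorder_sign A (sym_diff A X) * c * (if sym_diff A X = B then d else 0) else 0)"
      by (rule sum.cong[OF refl]) simp
    also have "\<dots> = reorder_sign A (sym_diff A X) * c * (if sym_diff A X = B then d else 0)"
      by simp
    also have "\<dots> = (if X = sym_diff A B then reorder_sign A B * c * d else 0)"
      unfolding eq[symmetric] by (cases "sym_diff A X = B") simp_all
    finally show ?thesis .
  qed
  then show ?thesis
    unfolding times_clifford_def by (simp add: Clifford_inverse)
qed

lemma blade_uminus: "- Clifford (\<lambda>X. if X = A then c else 0) = Clifford (\<lambda>X. if X = A then - c else 0)"
  unfolding uminus_clifford_def by (auto simp: Clifford_inverse intro!: arg_cong[where f = Clifford])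

lemma reorder_sign_singleton:
  fixes g h :: "'m::{finite,linorder} + 'm"
  shows "reorder_sign {g} {h} = (if gen_less h g then -1 else 1)"
  by (simp add: reorder_sign_prod)

lemma gen_less_irrefl: "\<not> gen_less g g"
  by (cases g) simp_all

lemma gen_less_total: "g \<noteq> h \<Longrightarrow> gen_less g h \<longleftrightarrow> \<not> gen_less h g"
  by (cases g; cases h) auto

lemma gen_square:
  fixes g :: "'m::{finite,linorder} + 'm"
  shows "gen g * gen g = 1"
  unfolding gen_def blade_mult
  by (simp add: one_clifford_def reorder_sign_singleton gen_less_irrefl cong: if_cong)

lemma gen_anticommute:
  fixes g h :: "'m::{finite,linorder} + 'm"
  assumes "g \<noteq> h"
  shows "gen g * gen h = - (gen h * gen g)"
proof -
  have 1: "reorder_sign {g} {h} = - reorder_sign {h} {g}"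
    using gen_less_total[OF assms] by (simp add: reorder_sign_singleton)
  have 2: "sym_diff {g} {h} = sym_diff {h} {g}" by blast
  show ?thesis
    unfolding gen_def blade_mult blade_uminus 1 2 mult_minus_left by (rule refl)
qed

lemma complex_unit_square: "complex_unit * complex_unit = - (1 :: 'm::{finite,linorder} clifford)"
  unfolding complex_unit_def blade_mult one_clifford_def blade_uminus by (simp cong: if_cong)

lemma complex_unit_commute: "complex_unit * x = x * complex_unit"
proof (unfold complex_unit_def, transfer, rule ext)
  fix x :: "('a + 'a) set \<Rightarrow> complex" and C
  have "sym_diff A C = {} \<longleftrightarrow> A = C" for A :: "('a + 'a) set" by blast
  then have "(\<Sum>A\<in>UNIV. reorder_sign A (sym_diff A C) * x A * (if sym_diff A C = {} then \<i> else 0)) =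
      (\<Sum>A\<in>UNIV. if A = C then x C * \<i> else 0)"
    by (intro sum.cong) auto
  moreover have "(\<Sum>A\<in>UNIV. reorder_sign A (sym_diff A C) * (if A = {} then \<i> else 0) * x (sym_diff A C)) =
      (\<Sum>A\<in>(UNIV :: ('a + 'a) set set). if A = {} then x C * \<i> else 0)"
    by (rule sum.cong[OF refl]) auto
  ultimately show "(\<Sum>A\<in>UNIV. reorder_sign A (sym_diff A C) * (if A = {} then \<i> else 0) * x (sym_diff A C)) =
      (\<Sum>A\<in>UNIV. reorder_sign A (sym_diff A C) * x A * (if sym_diff A C = {} then \<i> else 0))"
    by simp
qed

lemma complex_unit_gen:
  fixes g h :: "'m::{finite,linorder} + 'm"
  shows "(complex_unit * gen g) * gen h = complex_unit * (gen g * gen h)"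
    and "gen g * (complex_unit * gen h) = complex_unit * (gen g * gen h)"
    and "(complex_unit * gen g) * (complex_unit * gen h) = - (gen g * gen h)"
proof -
  show 1: "gen g * (complex_unit * gen h) = complex_unit * (gen g * gen h)" for g h :: "'m + 'm"
    by (metis complex_unit_commute mult.assoc)
  show "(complex_unit * gen g) * (complex_unit * gen h) = - (gen g * gen h)"
    by (simp add: mult.assoc 1) (metis complex_unit_square mult.assoc mult_minus1)
qed (rule mult.assoc)

lemma ep_em_orthogonal:
  fixes j k :: "'m::{finite,linorder}"
  assumes "j \<noteq> k"
  shows "ep j * ep k = - (ep k * ep j)" "em j * em k = - (em k * em j)" "ep j * em k = - (em k * ep j)"
    "em j * ep k = - (ep k * em j)"
proof -
  have "gen (Inl j) * gen (Inl k) = - (gen (Inl k) * gen (Inl j))"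
    "gen (Inr j) * gen (Inl k) = - (gen (Inl k) * gen (Inr j))"
    "gen (Inl j) * gen (Inr k) = - (gen (Inr k) * gen (Inl j))"
    "gen (Inr j) * gen (Inr k) = - (gen (Inr k) * gen (Inr j))"
    using assms by (auto intro!: gen_anticommute)
  note c = complex_unit_gen this
  show "ep j * ep k = - (ep k * ep j)" "em j * em k = - (em k * em j)" "ep j * em k = - (em k * ep j)"
    "em j * ep k = - (ep k * em j)"
    unfolding ep_def em_def mult_scaleR_left mult_scaleR_right scaleR_minus_right[symmetric]
    by (intro arg_cong[where f = "scaleR (1/2)"];
      simp only: left_diff_distrib right_diff_distrib distrib_left distrib_right c mult_minus_right; simp)+
qed

lemma ep_em_same:
  fixes j :: "'m::{finite,linorder}"
  shows "ep j * ep j = 0" "em j * em j = 0" "ep j * em j + em j * ep j = 1"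
proof -
  have "gen (Inr j) * gen (Inl j) = - (gen (Inl j) * gen (Inr j))"
    by (auto intro!: gen_anticommute)
  note c = complex_unit_gen this gen_square
  have 1: "(gen (Inl j) - complex_unit * gen (Inr j)) * (gen (Inl j) - complex_unit * gen (Inr j)) = 0"
    and 2: "(gen (Inl j) + complex_unit * gen (Inr j)) * (gen (Inl j) + complex_unit * gen (Inr j)) = 0"
    and 3: "(gen (Inl j) - complex_unit * gen (Inr j)) * (gen (Inl j) + complex_unit * gen (Inr j))
      + (gen (Inl j) + complex_unit * gen (Inr j)) * (gen (Inl j) - complex_unit * gen (Inr j)) = 4 *\<^sub>R 1"
    by (simp only: left_diff_distrib right_diff_distrib distrib_left distrib_right c mult_minus_right;
      simp add: scaleR_conv_of_real)+
  show "ep j * ep j = 0" "em j * em j = 0"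
    unfolding ep_def em_def mult_scaleR_left mult_scaleR_right 1 2 by simp_all
  show "ep j * em j + em j * ep j = 1"
    unfolding ep_def em_def mult_scaleR_left mult_scaleR_right scaleR_add_right[symmetric] 3 by simp
qed

lemma
  fixes j k :: "'m::{finite,linorder}"
  shows ep_ep: "ep j * ep k + ep k * ep j = 0"
    and em_em: "em j * em k + em k * em j = 0"
    and ep_em: "ep j * em k + em k * ep j = (if j = k then 1 else 0)"
  using ep_em_same[of j] ep_em_orthogonal[of j k] by (cases "j = k"; simp)+


lemma ep_em_orthogonal_assoc:
  fixes j k :: "'m::{finite,linorder}"
  assumes "j \<noteq> k"
  shows "ep j * (ep k * y) = - (ep k * (ep j * y))" "em j * (em k * y) = - (em k * (em j * y))"
    "ep j * (em k * y) = - (em k * (ep j * y))" "em j * (ep k * y) = - (ep k * (em j * y))"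
  by (simp_all only: mult.assoc[symmetric] ep_em_orthogonal[OF assms] mult_minus_left)

lemma ep_em_nilpotent:
  fixes j :: "'m::{finite,linorder}"
  shows "ep j * (ep j * y) = 0" "em j * (em j * y) = 0"
  by (simp_all only: mult.assoc[symmetric] ep_em_same mult_zero_left)

lemma ep_em_ep:
  fixes j :: "'m::{finite,linorder}"
  shows "ep j * (em j * ep j) = ep j" and "em j * (ep j * em j) = em j"
proof -
  have 1: "em j * ep j = 1 - ep j * em j" and 2: "ep j * em j = 1 - em j * ep j"
    using ep_em_same(3)[of j] by (simp_all add: algebra_simps)
  show "ep j * (em j * ep j) = ep j"
    unfolding 1 right_diff_distrib mult.assoc[symmetric] ep_em_same by simp
  show "em j * (ep j * em j) = em j"
    unfolding 2 right_diff_distrib mult.assoc[symmetric] ep_em_same by simp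
qed

section \<open>Discrete functions and the discrete Dirac operator\<close>

type_synonym 'm dfun = "int ^ 'm \<Rightarrow> 'm clifford"
type_synonym 'm operator = "'m dfun \<Rightarrow> 'm dfun"
type_synonym 'm multi = "nat ^ 'm"

definition fwd_diff :: "'m::{finite,linorder} \<Rightarrow> 'm operator" where
  "fwd_diff j f = (\<lambda>x. f (x + axis j 1) - f x)"

definition bwd_diff :: "'m::{finite,linorder} \<Rightarrow> 'm operator" where
  "bwd_diff j f = (\<lambda>x. f x - f (x - axis j 1))"

definition partial_dirac :: "'m::{finite,linorder} \<Rightarrow> 'm operator" where
  "partial_dirac j f = (\<lambda>x. ep j * fwd_diff j f x + em j * bwd_diff j f x)"

definition dirac :: "'m::{finite,linorder} operator" where
  "dirac f = (\<lambda>x. \<Sum>j\<in>UNIV. partial_dirac j f x)"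

definition star_laplacian :: "'m::{finite,linorder} operator" where
  "star_laplacian f = (\<lambda>x. \<Sum>j\<in>UNIV. f (x + axis j 1) + f (x - axis j 1) - 2 * f x)"

definition discrete_harmonic :: "'m::{finite,linorder} dfun \<Rightarrow> bool" where
  "discrete_harmonic f \<longleftrightarrow> star_laplacian f = (\<lambda>x. 0)"

lemma partial_dirac_anticommute:
  assumes "j \<noteq> k"
  shows "partial_dirac j (partial_dirac k f) x = - partial_dirac k (partial_dirac j f) x"
  unfolding partial_dirac_def fwd_diff_def bwd_diff_def
  by (simp add: algebra_simps ep_em_orthogonal_assoc[OF assms])

lemma partial_dirac_square:
  "partial_dirac j (partial_dirac j f) x = f (x + axis j 1) + f (x - axis j 1) - 2 * f x"
proof -
  let ?g = "f (x + axis j 1) + f (x - axis j 1) - f x - f x"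
  have "partial_dirac j (partial_dirac j f) x = ep j * (em j * ?g) + em j * (ep j * ?g)"
    unfolding partial_dirac_def fwd_diff_def bwd_diff_def by (simp add: ring_distribs ep_em_nilpotent)
  also have "\<dots> = (ep j * em j + em j * ep j) * ?g" by (simp add: distrib_right mult.assoc)
  finally show ?thesis by (simp add: ep_em_same mult_2 diff_diff_eq)
qed

lemma sum_antisymmetric:
  fixes a :: "'a \<Rightarrow> 'a \<Rightarrow> 'b::real_vector"
  assumes "\<And>j k. j \<noteq> k \<Longrightarrow> a j k = - a k j" "finite S"
  shows "(\<Sum>j\<in>S. \<Sum>k\<in>S. a j k) = (\<Sum>j\<in>S. a j j)"
proof -
  let ?b = "\<lambda>j k. if j = k then 0 else a j k"
  have "(\<Sum>j\<in>S. \<Sum>k\<in>S. ?b j k) = (\<Sum>j\<in>S. \<Sum>k\<in>S. ?b k j)" by (rule sum.swap)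
  also have "\<dots> = (\<Sum>j\<in>S. \<Sum>k\<in>S. - ?b j k)"
  proof (intro sum.cong refl)
    fix j k
    show "?b k j = - ?b j k" using assms(1)[of k j] by (cases "j = k") simp_all
  qed
  also have "\<dots> = - (\<Sum>j\<in>S. \<Sum>k\<in>S. ?b j k)" by (simp add: sum_negf)
  finally have "2 *\<^sub>R (\<Sum>j\<in>S. \<Sum>k\<in>S. ?b j k) = 0"
    by (simp only: eq_neg_iff_add_eq_0 scaleR_2)
  then have 0: "(\<Sum>j\<in>S. \<Sum>k\<in>S. ?b j k) = 0" by simp
  have "(\<Sum>j\<in>S. \<Sum>k\<in>S. a j k) = (\<Sum>j\<in>S. \<Sum>k\<in>S. ?b j k + (if j = k then a j j else 0))"
    by (intro sum.cong) auto
  also have "\<dots> = (\<Sum>j\<in>S. a j j)" using assms(2) by (simp add: sum.distrib 0)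
  finally show ?thesis .
qed

lemma partial_dirac_sum: "partial_dirac j (\<lambda>x. \<Sum>k\<in>S. f k x) = (\<lambda>x. \<Sum>k\<in>S. partial_dirac j (f k) x)"
  unfolding partial_dirac_def fwd_diff_def bwd_diff_def sum.distrib sum_distrib_left[symmetric] sum_subtractf
  by (rule refl)

lemma dirac_dirac: "dirac (dirac f) = star_laplacian f"
proof
  fix x
  have "dirac (dirac f) x = (\<Sum>j\<in>UNIV. \<Sum>k\<in>UNIV. partial_dirac j (partial_dirac k f) x)"
    unfolding dirac_def by (simp add: partial_dirac_sum)
  also have "\<dots> = (\<Sum>j\<in>UNIV. partial_dirac j (partial_dirac j f) x)"
    by (rule sum_antisymmetric) (auto intro: partial_dirac_anticommute)
  finally show "dirac (dirac f) x = star_laplacian f x"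
    by (simp add: partial_dirac_square star_laplacian_def)
qed

section \<open>Basic polynomials\<close>

definition before_degree :: "'m::{finite,linorder} multi \<Rightarrow> 'm \<Rightarrow> nat" where
  "before_degree \<alpha> j = (\<Sum>i\<in>{..<j}. \<alpha> $ i)"

definition multi_degree :: "'m::{finite,linorder} multi \<Rightarrow> nat" where
  "multi_degree \<alpha> = (\<Sum>i\<in>UNIV. \<alpha> $ i)"

text \<open>
  For \<open>\<alpha>\<^sub>j = 0\<close> the truncated index \<open>\<alpha> - axis j 1\<close> is irrelevant, since its coefficient \<open>\<alpha>\<^sub>j\<close> vanishes.
\<close>

definition is_basic_family :: "('m::{finite,linorder} multi \<Rightarrow> 'm dfun) \<Rightarrow> bool" where
  "is_basic_family p \<longleftrightarrow>
     p 0 = (\<lambda>x. 1) \<and>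
     (\<forall>\<alpha> j. partial_dirac j (p \<alpha>) =
        (\<lambda>x. (-1) ^ before_degree \<alpha> j * of_nat (\<alpha> $ j) * p (\<alpha> - axis j 1) x)) \<and>
     (\<forall>\<alpha>. \<alpha> \<noteq> 0 \<longrightarrow> p \<alpha> 0 = 0)"

definition basic_poly :: "'m::{finite,linorder} multi \<Rightarrow> 'm dfun" where
  "basic_poly = (THE p. is_basic_family p)"

lemma lattice_induct:
  fixes x :: "int ^ 'm::finite"
  assumes "P 0" "\<And>x j. P x \<Longrightarrow> P (x + axis j 1)" "\<And>x j. P x \<Longrightarrow> P (x - axis j 1)"
  shows "P x"
proof -
  have step: "P (y + axis j t)" if "P y" for y j and t :: int
  proof (induction t rule: int_induct[where k = 0])
    case base
    then show ?case using that by (simp add: axis_def vec_eq_iff[symmetric] flip: zero_vec_def)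
  next
    case (step1 i)
    have "y + axis j (i + 1) = y + axis j i + axis j 1" by (simp add: vec_eq_iff axis_def)
    then show ?case using assms(2)[OF step1(2)] by (simp only:)
  next
    case (step2 i)
    have "y + axis j (i - 1) = y + axis j i - axis j 1" by (simp add: vec_eq_iff axis_def)
    then show ?case using assms(3)[OF step2(2)] by (simp only:)
  qed
  have "P (\<chi> i. if i \<in> S then x $ i else 0)" if "finite S" for S
    using that
  proof (induction S)
    case empty
    then show ?case using assms(1) by (simp add: zero_vec_def)
  next
    case (insert j S)
    have "(\<chi> i. if i \<in> insert j S then x $ i else 0) = (\<chi> i. if i \<in> S then x $ i else 0) + axis j (x $ j)"
      using insert.hyps by (auto simp: vec_eq_iff axis_def)
    then show ?case using step[OF insert.IH] by simp
  qed
  from this[of UNIV] show ?thesis by simp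
qed

lemma ep_partial_dirac: "fwd_diff j f x = ep j * partial_dirac j f (x + axis j 1) + em j * partial_dirac j f x"
proof -
  let ?g = "f (x + axis j 1) - f x"
  have "ep j * partial_dirac j f (x + axis j 1) + em j * partial_dirac j f x
      = ep j * (em j * ?g) + em j * (ep j * ?g)"
    unfolding partial_dirac_def fwd_diff_def bwd_diff_def by (simp add: ring_distribs ep_em_nilpotent)
  also have "\<dots> = (ep j * em j + em j * ep j) * ?g" by (simp add: distrib_right mult.assoc)
  finally show ?thesis by (simp add: ep_em_same fwd_diff_def)
qed

lemma partial_dirac_zero_imp_const:
  assumes "\<And>j x. partial_dirac j f x = 0"
  shows "f x = f 0"
proof -
  have s: "f (x + axis j 1) = f x" for x j
    using ep_partial_dirac[of j f x] assms by (simp add: fwd_diff_def)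
  show ?thesis
  proof (induction x rule: lattice_induct)
    case (3 x j)
    then show ?case using s[of "x - axis j 1" j] by simp
  qed (simp_all add: s)
qed

lemma partial_dirac_diff: "partial_dirac j (\<lambda>x. f x - g x) = (\<lambda>x. partial_dirac j f x - partial_dirac j g x)"
  by (simp add: partial_dirac_def fwd_diff_def bwd_diff_def ring_distribs fun_eq_iff)

lemma multi_degree_minus_axis:
  assumes "\<alpha> $ j > 0"
  shows "multi_degree (\<alpha> - axis j 1) < multi_degree \<alpha>"
  unfolding multi_degree_def using assms
  by (intro sum_strict_mono_ex1) (auto simp: axis_def intro!: bexI[of _ j])

lemma is_basic_family_unique:
  assumes p: "is_basic_family p" and q: "is_basic_family q"
  shows "p = q"
proof
  fix \<alpha>
  show "p \<alpha> = q \<alpha>"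
  proof (induction "multi_degree \<alpha>" arbitrary: \<alpha> rule: less_induct)
    case less
    show ?case
    proof (cases "\<alpha> = 0")
      case True
      then show ?thesis using p q by (simp add: is_basic_family_def)
    next
      case False
      let ?g = "\<lambda>x. p \<alpha> x - q \<alpha> x"
      have "partial_dirac j ?g x = 0" for j x
      proof (cases "\<alpha> $ j = 0")
        case True
        then show ?thesis using p q by (simp add: partial_dirac_diff is_basic_family_def)
      next
        case False
        then have "p (\<alpha> - axis j 1) = q (\<alpha> - axis j 1)" by (intro less multi_degree_minus_axis) simp
        then show ?thesis using p q by (simp add: partial_dirac_diff is_basic_family_def)
      qed
      then have "?g x = ?g 0" for x by (rule partial_dirac_zero_imp_const)
      then show ?thesis using False p q by (auto simp: is_basic_family_def fun_eq_iff)
    qed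
  qed
qed

text \<open>
  The family is an ordered product of one-variable factors, with falling factorials as coefficients.
\<close>

definition ffact :: "int \<Rightarrow> nat \<Rightarrow> int" where
  "ffact y n = (\<Prod>k<n. y - int k)"

lemma ffact_Suc: "ffact y (Suc n) = ffact y n * (y - int n)"
  by (simp add: ffact_def)

lemma ffact_Suc': "ffact y (Suc n) = y * ffact (y - 1) n"
  unfolding ffact_def by (subst prod.lessThan_Suc_shift) (simp add: algebra_simps)

lemma ffact_diff: "ffact (y + 1) (Suc n) - ffact y (Suc n) = int (Suc n) * ffact y n"
  unfolding ffact_Suc[of y] ffact_Suc'[of "y + 1"] by (simp add: algebra_simps)

lemma ffact_eq_0: "0 \<le> y \<Longrightarrow> y < int n \<Longrightarrow> ffact y n = 0"
  unfolding ffact_def by (auto intro!: bexI[of _ "nat y"])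

definition cf_u :: "nat \<Rightarrow> int \<Rightarrow> int" where
  "cf_u n x = ffact (x + int (n div 2)) n"

definition cf_v :: "nat \<Rightarrow> int \<Rightarrow> int" where
  "cf_v n x = ffact (x + int (Suc n div 2) - 1) n"

lemma cf_diff:
  "cf_u (Suc n) x - cf_u (Suc n) (x - 1) = int (Suc n) * cf_v n x"
  "cf_v (Suc n) (x + 1) - cf_v (Suc n) x = int (Suc n) * cf_u n x"
  using ffact_diff[of "x + int (Suc n div 2) - 1" n] ffact_diff[of "x + int (n div 2)" n]
  by (simp_all add: cf_u_def cf_v_def algebra_simps)

lemma cf_eq_0:
  assumes "2 * nat \<bar>x\<bar> + 1 \<le> n"
  shows "cf_u n x = 0" "cf_v n x = 0"
proof -
  have "0 \<le> x + int (n div 2)" "x + int (n div 2) < int n"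
     "0 \<le> x + int (Suc n div 2) - 1" "x + int (Suc n div 2) - 1 < int n"
    using assms by linarith+
  then show "cf_u n x = 0" "cf_v n x = 0" unfolding cf_u_def cf_v_def by (auto intro: ffact_eq_0)
qed

definition factor :: "'m::{finite,linorder} \<Rightarrow> nat \<Rightarrow> int \<Rightarrow> 'm clifford" where
  "factor j n t =
     (if even n then of_int (cf_u n t) * (ep j * em j) + of_int (cf_v n t) * (em j * ep j)
      else of_int (cf_u n t) * ep j + of_int (cf_v n t) * em j)"

lemma factor_0: "factor j 0 t = 1"
  by (simp add: factor_def cf_u_def cf_v_def ffact_def ep_em_same)

lemma factor_eq_0: "2 * nat \<bar>t\<bar> + 1 \<le> n \<Longrightarrow> factor j n t = 0"
  by (simp add: factor_def cf_eq_0)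

lemma of_int_central: "x * (of_int i * y) = of_int i * (x * y)" for x y :: "'a::ring_1"
  by (metis mult.assoc mult_of_int_commute)

lemma factor_diff:
  "ep j * (factor j (Suc n) (t + 1) - factor j (Suc n) t) +
   em j * (factor j (Suc n) t - factor j (Suc n) (t - 1)) = of_nat (Suc n) * factor j n t"
proof -
  let ?du = "cf_u (Suc n) t - cf_u (Suc n) (t - 1)" and ?dv = "cf_v (Suc n) (t + 1) - cf_v (Suc n) t"
  have "ep j * (factor j (Suc n) (t + 1) - factor j (Suc n) t) +
        em j * (factor j (Suc n) t - factor j (Suc n) (t - 1)) =
       (if even n then of_int ?dv * (ep j * em j) + of_int ?du * (em j * ep j)
        else of_int ?dv * ep j + of_int ?du * em j)"
    by (simp add: factor_def ring_distribs of_int_central ep_em_nilpotent ep_em_same ep_em_ep)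
  also have "\<dots> = of_int (int (Suc n)) * factor j n t"
    unfolding cf_diff factor_def by (simp only: of_int_mult mult.assoc distrib_left split: if_split) simp
  finally show ?thesis by simp
qed

lemma factor_commute:
  assumes "i \<noteq> j"
  shows "ep j * factor i n t = (-1) ^ n * factor i n t * ep j"
    and "em j * factor i n t = (-1) ^ n * factor i n t * em j"
proof -
  note o = ep_em_orthogonal[OF assms[symmetric]] ep_em_orthogonal_assoc[OF assms[symmetric]]
  show "ep j * factor i n t = (-1) ^ n * factor i n t * ep j"
    and "em j * factor i n t = (-1) ^ n * factor i n t * em j"
    by (simp_all add: factor_def ring_distribs of_int_central o mult.assoc)
qed

definition explicit_poly :: "'m::{finite,linorder} multi \<Rightarrow> 'm dfun" where
  "explicit_poly \<alpha> x = prod_list (map (\<lambda>j. factor j (\<alpha> $ j) (x $ j)) (sorted_list_of_set UNIV))"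

lemma minus_one_power_central: "x * ((-1) ^ n * y) = (-1) ^ n * (x * y)" for x y :: "'a::ring_1"
  by (cases "even n") simp_all

lemma prod_factor_commute:
  assumes "j \<notin> set l"
  shows "ep j * prod_list (map (\<lambda>i. factor i (\<alpha> $ i) (x $ i)) l) =
      (-1) ^ (\<Sum>i\<leftarrow>l. \<alpha> $ i) * (prod_list (map (\<lambda>i. factor i (\<alpha> $ i) (x $ i)) l) * ep j)"
    and "em j * prod_list (map (\<lambda>i. factor i (\<alpha> $ i) (x $ i)) l) =
      (-1) ^ (\<Sum>i\<leftarrow>l. \<alpha> $ i) * (prod_list (map (\<lambda>i. factor i (\<alpha> $ i) (x $ i)) l) * em j)"
  using assms
proof (induction l)
  case (Cons i l)
  have *: "c * (f * p) = (-1) ^ (n + m) * (f * (p * c))"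
    if "c * f = (-1) ^ n * f * c" "c * p = (-1) ^ m * (p * c)" for c f p :: "'a clifford" and n m
  proof -
    have "c * (f * p) = (-1) ^ n * f * (c * p)" using that(1) by (simp flip: mult.assoc)
    also have "\<dots> = (-1) ^ n * ((-1) ^ m * (f * (p * c)))"
      unfolding that(2) by (simp only: mult.assoc minus_one_power_central[of f])
    finally show ?thesis by (simp add: power_add mult.assoc)
  qed
  {
    case 1
    then show ?case using Cons.IH(1) factor_commute(1)[of i j] by (auto simp: mult.assoc intro!: *[simplified mult.assoc])
  next
    case 2
    then show ?case using Cons.IH(2) factor_commute(2)[of i j] by (auto simp: mult.assoc intro!: *[simplified mult.assoc])
  }
qed simp_all

lemma explicit_poly_split:
  fixes j :: "'m::{finite,linorder}"
  obtains xs ys where "sorted_list_of_set (UNIV :: 'm set) = xs @ j # ys" "j \<notin> set xs" "j \<notin> set ys"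
    "set xs = {..<j}" "distinct xs"
proof -
  let ?L = "sorted_list_of_set (UNIV :: 'm set)"
  have "j \<in> set ?L" by simp
  then obtain xs ys where L: "?L = xs @ j # ys" by (meson split_list)
  have d: "distinct ?L" "sorted ?L" by simp_all
  have s: "set ?L = UNIV" by simp
  have "set xs = {..<j}"
    using d s unfolding L by (fastforce simp: sorted_append order.order_iff_strict)
  then show ?thesis using that L d(1) unfolding L by auto
qed

lemma explicit_poly_dirac:
  "partial_dirac j (explicit_poly \<alpha>) x =
     (-1) ^ before_degree \<alpha> j * of_nat (\<alpha> $ j) * explicit_poly (\<alpha> - axis j 1) x"
proof -
  obtain xs ys where L: "sorted_list_of_set (UNIV :: 'a set) = xs @ j # ys" "j \<notin> set xs" "j \<notin> set ys"
    "set xs = {..<j}" "distinct xs" by (rule explicit_poly_split)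
  define A where "A = prod_list (map (\<lambda>i. factor i (\<alpha> $ i) (x $ i)) xs)"
  define B where "B = prod_list (map (\<lambda>i. factor i (\<alpha> $ i) (x $ i)) ys)"
  have e: "explicit_poly \<beta> y = A * factor j (\<beta> $ j) (y $ j) * B"
    if "\<And>i. i \<noteq> j \<Longrightarrow> \<beta> $ i = \<alpha> $ i" "\<And>i. i \<noteq> j \<Longrightarrow> y $ i = x $ i" for \<beta> y
  proof -
    have "map (\<lambda>i. factor i (\<beta> $ i) (y $ i)) xs = map (\<lambda>i. factor i (\<alpha> $ i) (x $ i)) xs"
      "map (\<lambda>i. factor i (\<beta> $ i) (y $ i)) ys = map (\<lambda>i. factor i (\<alpha> $ i) (x $ i)) ys"
      using L(2,3) that by (auto intro!: map_cong) (metis that)+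
    then show ?thesis
      unfolding explicit_poly_def L(1) A_def B_def map_append list.map prod_list.append prod_list.Cons
      by (simp only: mult.assoc)
  qed
  have deg: "before_degree \<alpha> j = (\<Sum>i\<leftarrow>xs. \<alpha> $ i)"
    using L by (simp add: before_degree_def sum_list_distinct_conv_sum_set)
  have c: "ep j * (A * y) = (-1) ^ before_degree \<alpha> j * (A * (ep j * y))"
    "em j * (A * y) = (-1) ^ before_degree \<alpha> j * (A * (em j * y))" for y
    unfolding mult.assoc[symmetric] prod_factor_commute[OF L(2), of \<alpha> x, folded A_def deg] by simp_all
  have 1: "explicit_poly \<alpha> (x + axis j 1) = A * factor j (\<alpha> $ j) (x $ j + 1) * B"
    "explicit_poly \<alpha> (x - axis j 1) = A * factor j (\<alpha> $ j) (x $ j - 1) * B"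
    "explicit_poly \<alpha> x = A * factor j (\<alpha> $ j) (x $ j) * B"
    by (subst e; simp add: axis_def)+
  have 2: "explicit_poly (\<alpha> - axis j 1) x = A * factor j (\<alpha> $ j - 1) (x $ j) * B"
    by (subst e) (simp_all add: axis_def)
  have "partial_dirac j (explicit_poly \<alpha>) x = (-1) ^ before_degree \<alpha> j * (A *
      (ep j * (factor j (\<alpha> $ j) (x $ j + 1) - factor j (\<alpha> $ j) (x $ j)) +
       em j * (factor j (\<alpha> $ j) (x $ j) - factor j (\<alpha> $ j) (x $ j - 1))) * B)"
    unfolding partial_dirac_def fwd_diff_def bwd_diff_def 1
    by (simp add: mult.assoc ring_distribs c minus_one_power_central)
  also have "ep j * (factor j (\<alpha> $ j) (x $ j + 1) - factor j (\<alpha> $ j) (x $ j)) +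
       em j * (factor j (\<alpha> $ j) (x $ j) - factor j (\<alpha> $ j) (x $ j - 1)) =
       of_nat (\<alpha> $ j) * factor j (\<alpha> $ j - 1) (x $ j)"
    by (cases "\<alpha> $ j") (simp_all only: factor_diff diff_Suc_1 factor_0, simp)
  finally show ?thesis
    unfolding 2 by (simp add: mult.assoc) (metis mult.assoc mult_of_nat_commute)
qed

lemma explicit_poly_eq_0:
  assumes "2 * nat \<bar>x $ j\<bar> + 1 \<le> \<alpha> $ j"
  shows "explicit_poly \<alpha> x = 0"
proof -
  obtain xs ys where L: "sorted_list_of_set (UNIV :: 'a set) = xs @ j # ys" "j \<notin> set xs" "j \<notin> set ys"
    "set xs = {..<j}" "distinct xs" by (rule explicit_poly_split)
  show ?thesis by (simp add: explicit_poly_def L factor_eq_0[OF assms])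
qed

lemma explicit_poly_family: "is_basic_family explicit_poly"
  unfolding is_basic_family_def
proof (intro conjI allI impI)
  have "prod_list (map (\<lambda>j. 1 :: 'a clifford) l) = 1" for l :: "'a list" by (induction l) simp_all
  then show "explicit_poly (0 :: 'a multi) = (\<lambda>x. 1)"
    by (simp add: explicit_poly_def fun_eq_iff factor_0)
next
  fix \<alpha> :: "'a multi" assume "\<alpha> \<noteq> 0"
  then obtain j where "\<alpha> $ j \<noteq> 0" by (auto simp: vec_eq_iff)
  then show "explicit_poly \<alpha> 0 = 0" by (intro explicit_poly_eq_0[of _ j]) simp
qed (simp add: explicit_poly_dirac fun_eq_iff)

lemma is_basic_family_basic_poly: "is_basic_family basic_poly"
  unfolding basic_poly_def
  by (rule theI[where a = explicit_poly])
    (rule explicit_poly_family, erule is_basic_family_unique, rule explicit_poly_family)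

lemma basic_poly_eq_0: "2 * nat \<bar>x $ j\<bar> + 1 \<le> \<alpha> $ j \<Longrightarrow> basic_poly \<alpha> x = 0"
  using explicit_poly_eq_0 is_basic_family_unique[OF is_basic_family_basic_poly explicit_poly_family]
  by metis

section \<open>Taylor expansion\<close>

text \<open>
  By \<open>basic_poly_eq_0\<close> only finitely many summands are nonzero at each point, so the series is an
  honest finite sum there.
\<close>

definition taylor_series :: "('m::{finite,linorder} multi \<Rightarrow> 'm clifford) \<Rightarrow> 'm dfun" where
  "taylor_series c = (\<lambda>x. Sum_any (\<lambda>\<alpha>. basic_poly \<alpha> x * c \<alpha>))"

definition taylor_coeff :: "'m::{finite,linorder} dfun \<Rightarrow> 'm multi \<Rightarrow> 'm clifford" where
  "taylor_coeff f = (THE c. f = taylor_series c)"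

lemma partial_dirac_basic_poly:
  "partial_dirac j (basic_poly \<alpha>) =
     (\<lambda>x. (-1) ^ before_degree \<alpha> j * of_nat (\<alpha> $ j) * basic_poly (\<alpha> - axis j 1) x)"
  using is_basic_family_basic_poly unfolding is_basic_family_def by blast

lemma finite_multi_le: "finite {\<alpha> :: nat ^ 'm::finite. \<forall>i. \<alpha> $ i \<le> N}"
proof -
  have "{\<alpha> :: nat ^ 'm. \<forall>i. \<alpha> $ i \<le> N} \<subseteq> vec_lambda ` PiE UNIV (\<lambda>_. {..N})"
  proof
    fix \<alpha> :: "nat ^ 'm" assume "\<alpha> \<in> {\<alpha>. \<forall>i. \<alpha> $ i \<le> N}"
    then show "\<alpha> \<in> vec_lambda ` PiE UNIV (\<lambda>_. {..N})"
      by (intro image_eqI[of _ _ "vec_nth \<alpha>"]) (auto simp: vec_nth_inverse)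
  qed
  then show ?thesis by (rule finite_subset) (intro finite_imageI finite_PiE; simp)
qed

lemma taylor_series_eq:
  assumes "\<And>i. 2 * nat \<bar>x $ i\<bar> \<le> N"
  shows "taylor_series c x = (\<Sum>\<alpha>\<in>{\<alpha>. \<forall>i. \<alpha> $ i \<le> N}. basic_poly \<alpha> x * c \<alpha>)"
  unfolding taylor_series_def
proof (rule Sum_any.expand_superset[OF finite_multi_le], safe)
  fix \<alpha> i
  assume "basic_poly \<alpha> x * c \<alpha> \<noteq> 0"
  then have "basic_poly \<alpha> x \<noteq> 0" by auto
  then have "\<not> 2 * nat \<bar>x $ i\<bar> + 1 \<le> \<alpha> $ i" using basic_poly_eq_0 by blast
  then show "\<alpha> $ i \<le> N" using assms[of i] by linarith
qed

lemma taylor_series_0: "taylor_series c 0 = c 0"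
proof -
  have "basic_poly \<alpha> 0 = (if \<alpha> = 0 then 1 else 0 :: 'a clifford)" for \<alpha>
    using is_basic_family_basic_poly by (auto simp: is_basic_family_def)
  then have eq: "(\<lambda>\<alpha>. basic_poly \<alpha> 0 * c \<alpha>) = (\<lambda>\<alpha>. if \<alpha> = 0 then c \<alpha> else 0)" by auto
  show ?thesis unfolding taylor_series_def eq by (rule Sum_any.delta)
qed

definition coeff_shift ::
    "'m::{finite,linorder} \<Rightarrow> ('m multi \<Rightarrow> 'm clifford) \<Rightarrow> 'm multi \<Rightarrow> 'm clifford" where
  "coeff_shift j c \<alpha> = ((-1) ^ before_degree \<alpha> j * real (\<alpha> $ j + 1)) *\<^sub>R c (\<alpha> + axis j 1)"

lemma before_degree_axis: "before_degree (\<alpha> + axis j 1) j = before_degree \<alpha> j"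
  unfolding before_degree_def by (rule sum.cong) (auto simp: axis_def)

lemma signed_nat_scaleR: "(-1) ^ b * of_nat n * y * c = y * (((-1) ^ b * real n) *\<^sub>R c)"
  for y c :: "'a::real_algebra_1"
proof -
  have "(-1) ^ b * of_nat n = (of_real ((-1) ^ b * real n) :: 'a)" by simp
  then show ?thesis by (simp add: scaleR_conv_of_real[symmetric] del: of_real_mult)
qed

lemma partial_dirac_taylor_series: "partial_dirac j (taylor_series c) = taylor_series (coeff_shift j c)"
proof
  fix x :: "(int, 'a) vec"
  define N where "N = (\<Sum>i\<in>UNIV. 2 * nat \<bar>x $ i\<bar>) + 4"
  define B where "B n = {\<alpha> :: 'a multi. \<forall>i. \<alpha> $ i \<le> n}" for n
  have le: "2 * nat \<bar>x $ i\<bar> + 4 \<le> N" for i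
    unfolding N_def using member_le_sum[of i UNIV "\<lambda>i. 2 * nat \<bar>x $ i\<bar>"] by simp
  have ts: "taylor_series c y = (\<Sum>\<alpha>\<in>B (N + 1). basic_poly \<alpha> y * c \<alpha>)"
    if "\<And>i. \<bar>y $ i\<bar> \<le> \<bar>x $ i\<bar> + 1" for y :: "(int, 'a) vec" and c
    unfolding B_def
  proof (rule taylor_series_eq)
    fix i
    show "2 * nat \<bar>y $ i\<bar> \<le> N + 1" using le[of i] that[of i] by linarith
  qed
  have tx: "taylor_series d x = (\<Sum>\<alpha>\<in>B N. basic_poly \<alpha> x * d \<alpha>)" for d
    unfolding B_def using le by (intro taylor_series_eq) (meson add_leD1)
  let ?t = "\<lambda>\<alpha>. (-1) ^ before_degree \<alpha> j * of_nat (\<alpha> $ j) * basic_poly (\<alpha> - axis j 1) x * c \<alpha>"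
  have "partial_dirac j (taylor_series c) x = (\<Sum>\<alpha>\<in>B (N + 1). partial_dirac j (basic_poly \<alpha>) x * c \<alpha>)"
    unfolding partial_dirac_def fwd_diff_def bwd_diff_def
    by (subst (1 2 3 4) ts)
      (auto simp: axis_def sum_distrib_left sum.distrib sum_subtractf ring_distribs mult.assoc)
  also have "\<dots> = (\<Sum>\<alpha>\<in>B (N + 1). ?t \<alpha>)"
    by (simp only: partial_dirac_basic_poly)
  also have "\<dots> = (\<Sum>\<alpha>\<in>(\<lambda>\<beta>. \<beta> + axis j 1) ` B N. ?t \<alpha>)"
  proof (rule sum.mono_neutral_right)
    show "finite (B (N + 1))" unfolding B_def by (rule finite_multi_le)
    show "(\<lambda>\<beta>. \<beta> + axis j 1) ` B N \<subseteq> B (N + 1)" by (auto simp: B_def axis_def le_SucI)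
    show "\<forall>\<alpha>\<in>B (N + 1) - (\<lambda>\<beta>. \<beta> + axis j 1) ` B N. ?t \<alpha> = 0"
    proof
      fix \<alpha> assume \<alpha>: "\<alpha> \<in> B (N + 1) - (\<lambda>\<beta>. \<beta> + axis j 1) ` B N"
      show "?t \<alpha> = 0"
      proof (cases "\<alpha> $ j = 0")
        case False
        then have "\<alpha> = (\<alpha> - axis j 1) + axis j 1" by (auto simp: vec_eq_iff axis_def)
        then have "\<alpha> - axis j 1 \<notin> B N" using \<alpha> by blast
        then obtain i where "\<not> (\<alpha> - axis j 1) $ i \<le> N" by (auto simp: B_def)
        then have "2 * nat \<bar>x $ i\<bar> + 1 \<le> (\<alpha> - axis j 1) $ i" using le[of i] by linarith
        then show ?thesis by (simp only: basic_poly_eq_0 mult_zero_left mult_zero_right)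
      qed simp
    qed
  qed
  also have "\<dots> = (\<Sum>\<beta>\<in>B N. ?t (\<beta> + axis j 1))"
    by (subst sum.reindex) (auto simp: inj_on_def)
  also have "\<dots> = (\<Sum>\<beta>\<in>B N. basic_poly \<beta> x * coeff_shift j c \<beta>)"
  proof (rule sum.cong[OF refl])
    fix \<beta> :: "'a multi"
    have "(\<beta> + axis j 1) - axis j 1 = \<beta>" "(\<beta> + axis j 1) $ j = \<beta> $ j + 1" by (simp_all add: vec_eq_iff axis_def)
    then show "?t (\<beta> + axis j 1) = basic_poly \<beta> x * coeff_shift j c \<beta>"
      by (simp only: signed_nat_scaleR coeff_shift_def before_degree_axis)
  qed
  also have "\<dots> = taylor_series (coeff_shift j c) x" by (rule tx[symmetric])
  finally show "partial_dirac j (taylor_series c) x = taylor_series (coeff_shift j c) x" .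
qed

lemma taylor_series_inj:
  assumes "taylor_series c = taylor_series d"
  shows "c \<alpha> = d \<alpha>"
  using assms
proof (induction "multi_degree \<alpha>" arbitrary: \<alpha> c d rule: less_induct)
  case less
  show ?case
  proof (cases "\<alpha> = 0")
    case True
    then show ?thesis using less.prems taylor_series_0 by metis
  next
    case False
    then obtain j where j: "\<alpha> $ j > 0" by (auto simp: vec_eq_iff)
    have "taylor_series (coeff_shift j c) = taylor_series (coeff_shift j d)"
      using less.prems by (simp flip: partial_dirac_taylor_series)
    then have "coeff_shift j c (\<alpha> - axis j 1) = coeff_shift j d (\<alpha> - axis j 1)"
      by (rule less.hyps[OF multi_degree_minus_axis[OF j]])
    moreover have "\<alpha> - axis j 1 + axis j 1 = \<alpha>" using j by (auto simp: vec_eq_iff axis_def)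
    ultimately show ?thesis by (simp add: coeff_shift_def)
  qed
qed

lemma foldr_partial_dirac_zero:
  assumes "\<And>w. foldr partial_dirac w h 0 = 0"
  shows "h x = 0"
  using assms
proof (induction x arbitrary: h rule: lattice_induct)
  case 1
  from 1[of "[]"] show ?case by simp
next
  case (2 x j)
  have w: "foldr partial_dirac w (partial_dirac j h) 0 = 0"
    "foldr partial_dirac w (partial_dirac j (partial_dirac j h)) 0 = 0" for w
    using 2(2)[of "w @ [j]"] 2(2)[of "w @ [j, j]"] by simp_all
  have z: "h x = 0" "partial_dirac j h x = 0" "partial_dirac j (partial_dirac j h) x = 0"
    using 2 w by blast+
  have "partial_dirac j h (x + axis j 1) = ep j * partial_dirac j (partial_dirac j h) (x + axis j 1)"
    using ep_partial_dirac[of j "partial_dirac j h" x] z by (simp add: fwd_diff_def)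
  then show ?case
    using ep_partial_dirac[of j h x] z by (simp add: fwd_diff_def ep_em_nilpotent)
next
  case (3 x j)
  have w: "foldr partial_dirac w (partial_dirac j h) 0 = 0"
    "foldr partial_dirac w (partial_dirac j (partial_dirac j h)) 0 = 0" for w
    using 3(2)[of "w @ [j]"] 3(2)[of "w @ [j, j]"] by simp_all
  have z: "h x = 0" "partial_dirac j h x = 0" "partial_dirac j (partial_dirac j h) x = 0"
    using 3 w by blast+
  have "- partial_dirac j h (x - axis j 1) = em j * partial_dirac j (partial_dirac j h) (x - axis j 1)"
    using ep_partial_dirac[of j "partial_dirac j h" "x - axis j 1"] z by (simp add: fwd_diff_def)
  then have "em j * - partial_dirac j h (x - axis j 1) = 0" by (simp only: ep_em_nilpotent)
  then show ?case
    using ep_partial_dirac[of j h "x - axis j 1"] z by (simp add: fwd_diff_def)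
qed

definition iterated_dirac :: "'m::{finite,linorder} multi \<Rightarrow> 'm operator" where
  "iterated_dirac \<alpha> f = fold (\<lambda>j. partial_dirac j ^^ (\<alpha> $ j)) (sorted_list_of_set UNIV) f"

definition dirac_coeff :: "'m::{finite,linorder} dfun \<Rightarrow> 'm multi \<Rightarrow> 'm clifford" where
  "dirac_coeff f \<alpha> = (1 / (\<Prod>j\<in>UNIV. fact (\<alpha> $ j))) *\<^sub>R iterated_dirac \<alpha> f 0"

lemma partial_dirac_scaleR: "partial_dirac j (\<lambda>x. r *\<^sub>R f x) = (\<lambda>x. r *\<^sub>R partial_dirac j f x)"
  by (simp add: partial_dirac_def fwd_diff_def bwd_diff_def scaleR_right_distrib scaleR_right_diff_distrib
      right_diff_distrib fun_eq_iff)

lemma partial_dirac_power_scaleR: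
  "(partial_dirac j ^^ n) (\<lambda>x. r *\<^sub>R f x) = (\<lambda>x. r *\<^sub>R (partial_dirac j ^^ n) f x)"
  by (induction n) (simp_all add: partial_dirac_scaleR)

lemma fold_dirac_scaleR:
  "fold (\<lambda>j. partial_dirac j ^^ (\<alpha> $ j)) l (\<lambda>x. r *\<^sub>R f x) =
    (\<lambda>x. r *\<^sub>R fold (\<lambda>j. partial_dirac j ^^ (\<alpha> $ j)) l f x)"
  by (induction l arbitrary: f) (simp_all add: partial_dirac_power_scaleR)

lemma partial_dirac_power_commute:
  assumes "i \<noteq> j"
  shows "(partial_dirac i ^^ n) (partial_dirac j f) = (\<lambda>x. (-1) ^ n *\<^sub>R partial_dirac j ((partial_dirac i ^^ n) f) x)"
proof (induction n)
  case (Suc n)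
  have "partial_dirac i (partial_dirac j g) = (\<lambda>x. (-1) *\<^sub>R partial_dirac j (partial_dirac i g) x)" for g
    using partial_dirac_anticommute[OF assms, of g] by auto
  then show ?case by (simp add: Suc partial_dirac_scaleR)
qed simp

lemma fold_dirac_commute:
  assumes "j \<notin> set l"
  shows "fold (\<lambda>i. partial_dirac i ^^ (\<alpha> $ i)) l (partial_dirac j f) =
    (\<lambda>x. (-1) ^ (\<Sum>i\<leftarrow>l. \<alpha> $ i) *\<^sub>R partial_dirac j (fold (\<lambda>i. partial_dirac i ^^ (\<alpha> $ i)) l f) x)"
  using assms
proof (induction l arbitrary: f)
  case (Cons i l)
  then have "i \<noteq> j" by auto
  then show ?case
    using Cons by (simp add: partial_dirac_power_commute fold_dirac_scaleR power_add)
qed simp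

lemma iterated_dirac_partial_dirac:
  "iterated_dirac \<alpha> (partial_dirac j f) = (\<lambda>x. (-1) ^ before_degree \<alpha> j *\<^sub>R iterated_dirac (\<alpha> + axis j 1) f x)"
proof -
  obtain xs ys where L: "sorted_list_of_set (UNIV :: 'a set) = xs @ j # ys" "j \<notin> set xs" "j \<notin> set ys"
    "set xs = {..<j}" "distinct xs" by (rule explicit_poly_split)
  have deg: "(\<Sum>i\<leftarrow>xs. \<alpha> $ i) = before_degree \<alpha> j"
    using L by (simp add: before_degree_def sum_list_distinct_conv_sum_set)
  let ?F = "\<lambda>\<beta>. fold (\<lambda>i. partial_dirac i ^^ (\<beta> $ i))"
  have it: "iterated_dirac \<beta> g = ?F \<beta> ys ((partial_dirac j ^^ (\<beta> $ j)) (?F \<beta> xs g))" for \<beta> and g :: "'a dfun"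
    unfolding iterated_dirac_def L(1) by simp
  have F: "?F (\<alpha> + axis j 1) l g = ?F \<alpha> l g" if "j \<notin> set l" for l and g :: "'a dfun"
    using that by (intro fold_cong) (auto simp: axis_def)
  have n: "(\<alpha> + axis j 1) $ j = Suc (\<alpha> $ j)" by (simp add: axis_def)
  have "iterated_dirac \<alpha> (partial_dirac j f) =
      (\<lambda>x. (-1) ^ before_degree \<alpha> j *\<^sub>R ?F \<alpha> ys ((partial_dirac j ^^ (\<alpha> $ j)) (partial_dirac j (?F \<alpha> xs f))) x)"
    unfolding it by (simp add: fold_dirac_commute[OF L(2)] deg partial_dirac_power_scaleR fold_dirac_scaleR)
  then show ?thesis
    unfolding it F[OF L(2)] F[OF L(3)] n by (simp add: funpow_swap1)
qed

lemma dirac_coeff_partial_dirac: "dirac_coeff (partial_dirac j f) = coeff_shift j (dirac_coeff f)"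
proof
  fix \<alpha> :: "'a multi"
  have "(\<Prod>i\<in>UNIV. fact ((\<alpha> + axis j 1) $ i)) =
      fact (\<alpha> $ j + 1) * (\<Prod>i\<in>UNIV - {j}. fact (\<alpha> $ i) :: real)"
    by (subst prod.remove[of _ j]) (auto simp: axis_def intro!: prod.cong)
  also have "\<dots> = real (\<alpha> $ j + 1) * (\<Prod>i\<in>UNIV. fact (\<alpha> $ i))"
    by (subst (2) prod.remove[of _ j]) auto
  finally have f: "(\<Prod>i\<in>UNIV. fact ((\<alpha> + axis j 1) $ i)) = real (\<alpha> $ j + 1) * (\<Prod>i\<in>UNIV. fact (\<alpha> $ i))" .
  have n: "real (\<alpha> $ j + 1) \<noteq> 0" by simp
  show "dirac_coeff (partial_dirac j f) \<alpha> = coeff_shift j (dirac_coeff f) \<alpha>"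
    unfolding dirac_coeff_def coeff_shift_def iterated_dirac_partial_dirac f using n
    by (simp add: divide_simps del: of_nat_Suc of_nat_add)
qed

lemma dirac_coeff_0: "dirac_coeff f 0 = f 0"
proof -
  have "fold (\<lambda>j. id) l f = f" for l :: "'a list" by (induction l) auto
  then show ?thesis by (simp add: dirac_coeff_def iterated_dirac_def id_def funpow_0 zero_vec_def)
qed

lemma taylor_series_dirac_coeff: "f = taylor_series (dirac_coeff f)"
proof -
  let ?g = "taylor_series (dirac_coeff f)"
  have "foldr partial_dirac w (\<lambda>x. f x - ?g x) 0 = 0" for w
  proof -
    have 1: "foldr partial_dirac w (\<lambda>x. f x - ?g x) =
        (\<lambda>x. foldr partial_dirac w f x - foldr partial_dirac w ?g x)"
      by (induction w) (simp_all add: partial_dirac_diff)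
    have 2: "foldr partial_dirac w ?g = taylor_series (foldr coeff_shift w (dirac_coeff f))"
      by (induction w) (simp_all add: partial_dirac_taylor_series)
    have 3: "foldr coeff_shift w (dirac_coeff f) = dirac_coeff (foldr partial_dirac w f)"
      by (induction w) (simp_all add: dirac_coeff_partial_dirac)
    show ?thesis unfolding 1 2 3 by (simp add: taylor_series_0 dirac_coeff_0)
  qed
  then have "f x - ?g x = 0" for x by (rule foldr_partial_dirac_zero)
  then show ?thesis by (simp add: fun_eq_iff)
qed

lemma taylor_series_unique: "f = taylor_series c \<longleftrightarrow> c = taylor_coeff f"
proof -
  have ex1: "\<exists>!c. f = taylor_series c"
    using taylor_series_dirac_coeff taylor_series_inj by (metis ext)
  show ?thesis unfolding taylor_coeff_def using theI'[OF ex1] ex1 by blast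
qed

lemma taylor_coeff_uminus: "taylor_coeff (\<lambda>x. - f x) = (\<lambda>\<alpha>. - taylor_coeff f \<alpha>)"
proof -
  have f: "f = taylor_series (taylor_coeff f)" by (simp add: taylor_series_unique)
  have "taylor_series (\<lambda>\<alpha>. - taylor_coeff f \<alpha>) = (\<lambda>x. - taylor_series (taylor_coeff f) x)"
    unfolding taylor_series_def by (simp add: Sum_any.expand_set sum_negf)
  then show ?thesis using f by (metis taylor_series_unique)
qed

section \<open>The vector variable operators and the spin group\<close>

text \<open>
  \<open>termwise T\<close> is the right-linear operator with values \<open>T \<alpha>\<close> on the basic polynomials, extended
  termwise to Taylor series; for every \<open>T\<close> used below the sum is finite at each point.
\<close>

definition termwise :: "('m::{finite,linorder} multi \<Rightarrow> 'm dfun) \<Rightarrow> 'm operator" where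
  "termwise T f = (\<lambda>x. Sum_any (\<lambda>\<alpha>. T \<alpha> x * taylor_coeff f \<alpha>))"

definition xi_op :: "'m::{finite,linorder} \<Rightarrow> 'm operator" where
  "xi_op j = termwise (\<lambda>\<alpha> x. (-1) ^ before_degree \<alpha> j * basic_poly (\<alpha> + axis j 1) x)"

definition R_op :: "'m::{finite,linorder} \<Rightarrow> 'm operator" where
  "R_op j = termwise (\<lambda>\<alpha> x. (-1) ^ (multi_degree \<alpha> - \<alpha> $ j) * basic_poly \<alpha> x * (ep j + em j))"

definition xi :: "'m::{finite,linorder} operator" where
  "xi f = (\<lambda>x. \<Sum>j\<in>UNIV. xi_op j f x)"

definition op_inner :: "'m::{finite,linorder} operator \<Rightarrow> 'm operator \<Rightarrow> 'm operator" where
  "op_inner X Y f = (\<lambda>x. (1/2) *\<^sub>R (X (Y f) x + Y (X f) x))"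

definition op_neg :: "'m::{finite,linorder} operator \<Rightarrow> 'm operator" where
  "op_neg X f = (\<lambda>x. - X f x)"

definition op_prod :: "'m::{finite,linorder} operator list \<Rightarrow> 'm operator" where
  "op_prod ws = foldr (\<circ>) ws id"

definition vector_op :: "real ^ 'm::{finite,linorder} \<Rightarrow> 'm operator" where
  "vector_op \<omega> f = (\<lambda>x. \<Sum>j\<in>UNIV. (\<omega> $ j) *\<^sub>R R_op j f x)"

definition vector_sphere :: "'m::{finite,linorder} operator set" where
  "vector_sphere = {w \<in> range vector_op. w \<circ> w = id}"

definition spin_group :: "'m::{finite,linorder} operator set" where
  "spin_group = {op_prod ws |ws. set ws \<subseteq> vector_sphere \<and> even (length ws)}"

text \<open>
  The conjugation on \<open>spin_group\<close>: it is \<open>-1\<close> on vectors and reverses products. The value does not depend on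
  the chosen factorisation.
\<close>

definition spin_conj :: "'m::{finite,linorder} operator \<Rightarrow> 'm operator" where
  "spin_conj s = (THE t. \<exists>ws. set ws \<subseteq> vector_sphere \<and> even (length ws) \<and>
     s = op_prod ws \<and> t = op_prod (map op_neg (rev ws)))"

lemma taylor_coeff_R_op:
  "taylor_coeff (R_op j f) = (\<lambda>\<alpha>. (-1) ^ (multi_degree \<alpha> - \<alpha> $ j) * ((ep j + em j) * taylor_coeff f \<alpha>))"
    (is "_ = ?c")
proof -
  have "R_op j f = taylor_series ?c"
    unfolding R_op_def termwise_def taylor_series_def
    by (rule ext, rule arg_cong[where f = Sum_any], rule ext)
      (simp only: mult.assoc minus_one_power_central[of "basic_poly _ _"])
  then show ?thesis by (simp add: taylor_series_unique)
qed

lemma R_op_square: "R_op j (R_op j f) = f"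
proof -
  have "(ep j + em j) * (ep j + em j) = 1"
    using ep_em_same[of j] by (simp add: ring_distribs add.commute)
  then have e: "(ep j + em j) * ((ep j + em j) * y) = y" for y
    by (simp only: mult.assoc[symmetric] mult_1_left)
  have s: "(-1) ^ n * ((-1) ^ n * y) = y" for n and y :: "'a clifford"
    by (cases "even n") simp_all
  have "taylor_coeff (R_op j (R_op j f)) = taylor_coeff f"
    unfolding taylor_coeff_R_op by (simp only: minus_one_power_central[of "ep j + em j"] e s)
  then show ?thesis by (metis taylor_series_unique)
qed

lemma R_op_anticommute:
  assumes "j \<noteq> k"
  shows "R_op j (R_op k f) = (\<lambda>x. - R_op k (R_op j f) x)"
proof -
  have e: "(ep j + em j) * ((ep k + em k) * y) = - ((ep k + em k) * ((ep j + em j) * y))" for y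
    by (simp add: ring_distribs ep_em_orthogonal_assoc[OF assms])
  have s: "(-1) ^ n * ((-1) ^ m * y) = (-1) ^ m * ((-1) ^ n * y)" for n m and y :: "'a clifford"
    by (simp add: add.commute flip: mult.assoc power_add)
  have "taylor_coeff (R_op j (R_op k f)) = (\<lambda>\<alpha>. - taylor_coeff (R_op k (R_op j f)) \<alpha>)"
    unfolding taylor_coeff_R_op
    by (simp only: minus_one_power_central[of "ep j + em j"] minus_one_power_central[of "ep k + em k"] e
        mult_minus_right) (subst s, rule refl)
  then have "taylor_coeff (R_op j (R_op k f)) = taylor_coeff (\<lambda>x. - R_op k (R_op j f) x)"
    by (simp only: taylor_coeff_uminus)
  then show ?thesis by (metis taylor_series_unique)
qed

lemma R_op_uminus: "R_op j (\<lambda>x. - f x) = (\<lambda>x. - R_op j f x)"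
  unfolding R_op_def termwise_def taylor_coeff_uminus by (simp add: Sum_any.expand_set sum_negf)

lemma op_prod_append: "op_prod (us @ vs) = op_prod us \<circ> op_prod vs"
  unfolding op_prod_def by (induction us) (simp_all add: comp_assoc)

lemma vector_op_uminus: "w \<in> range vector_op \<Longrightarrow> w (\<lambda>x. - g x) = (\<lambda>x. - w g x)"
  by (auto simp: vector_op_def R_op_uminus sum_negf)

lemma op_prod_conj:
  assumes "set ws \<subseteq> vector_sphere"
  shows "op_prod (map op_neg (rev ws)) (op_prod ws f) = (\<lambda>x. (-1) ^ length ws * f x)"
    and "op_prod ws (op_prod (map op_neg (rev ws)) f) = (\<lambda>x. (-1) ^ length ws * f x)"
  using assms
proof (induction ws arbitrary: f)
  case (Cons w ws)
  {
    case 1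
    then have w: "w (w g) = g" for g by (auto simp: vector_sphere_def fun_eq_iff)
    have m: "op_prod (map op_neg (rev us)) (\<lambda>x. - g x) = (\<lambda>x. - op_prod (map op_neg (rev us)) g x)"
      if "set us \<subseteq> vector_sphere" for us g
      using that
    proof (induction us arbitrary: g)
      case Nil
      then show ?case by (simp add: op_prod_def)
    next
      case (Cons u us)
      then have "u (\<lambda>x. - g x) = (\<lambda>x. - u g x)" by (intro vector_op_uminus) (auto simp: vector_sphere_def)
      then show ?case using Cons by (simp add: op_prod_append op_neg_def) (simp add: op_prod_def op_neg_def)
    qed
    show ?case
      using 1 Cons.IH(1) m[of ws] by (simp add: op_prod_append) (simp add: op_prod_def op_neg_def w)
  next
    case 2
    then have w: "w (w g) = g" "w (\<lambda>x. - g x) = (\<lambda>x. - w g x)" for g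
      by (auto simp: vector_sphere_def fun_eq_iff intro!: vector_op_uminus[unfolded fun_eq_iff, rule_format])
    have "(\<lambda>x. (-1) ^ length ws * op_neg w f x) = (\<lambda>x. - ((-1) ^ length ws * w f x))" by (simp add: op_neg_def)
    moreover have "w (\<lambda>x. (-1) ^ n * g x) = (\<lambda>x. (-1) ^ n * w g x)" for n g
      by (cases "even n") (simp_all add: w)
    ultimately show ?case
      using 2 Cons.IH(2)[of "op_neg w f"] by (simp add: op_prod_append) (simp add: op_prod_def op_neg_def w)
  }
qed (simp_all add: op_prod_def)

lemma spin_conj_inverse:
  assumes "s \<in> spin_group"
  shows "spin_conj s \<circ> s = id" and "s \<circ> spin_conj s = id"
proof -
  let ?P = "\<lambda>t. \<exists>ws. set ws \<subseteq> vector_sphere \<and> even (length ws) \<and>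
     s = op_prod ws \<and> t = op_prod (map op_neg (rev ws))"
  have inv: "t \<circ> s = id \<and> s \<circ> t = id" if "?P t" for t
    using that op_prod_conj by (fastforce simp: fun_eq_iff)
  obtain t where t: "?P t" using assms by (auto simp: spin_group_def)
  moreover have "t' = t" if "?P t'" for t'
    using inv[OF that] inv[OF t] by (metis comp_assoc comp_id id_comp)
  ultimately have "?P (spin_conj s)" unfolding spin_conj_def by (rule theI)
  then show "spin_conj s \<circ> s = id" and "s \<circ> spin_conj s = id" using inv by blast+
qed

section \<open>Substitution and the two representations\<close>

definition var_component :: "'m::{finite,linorder} operator \<Rightarrow> 'm \<Rightarrow> 'm operator" where
  "var_component \<eta> j = op_inner \<eta> (R_op j) \<circ> R_op j"

definition var_monomial :: "('m::{finite,linorder} \<Rightarrow> 'm operator) \<Rightarrow> 'm multi \<Rightarrow> 'm dfun" where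
  "var_monomial \<eta> \<alpha> = foldr (\<lambda>j. \<eta> j ^^ (\<alpha> $ j)) (sorted_list_of_set UNIV) (\<lambda>x. 1)"

definition substitute :: "'m::{finite,linorder} operator \<Rightarrow> 'm operator" where
  "substitute \<eta> = termwise (var_monomial (var_component \<eta>))"

definition H0 :: "'m::{finite,linorder} operator \<Rightarrow> 'm operator" where
  "H0 s f = substitute (spin_conj s \<circ> xi \<circ> s) f"

text \<open>\<open>spin_conj s\<close> applied to \<open>1\<close> is a constant function; its value is read off at the origin.\<close>

definition H1 :: "'m::{finite,linorder} operator \<Rightarrow> 'm operator" where
  "H1 s f = (\<lambda>x. s (H0 s f) x * spin_conj s (\<lambda>x. 1) 0)"

end

theory Submission
  imports Defs
begin

text \<open>
  The operators \<open>X\<^sub>j = R\<^sub>j \<xi>\<^sub>j\<close> commute with each other and with all \<open>R\<^sub>k\<close>, and \<open>\<xi>\<^sub>j = R\<^sub>j X\<^sub>j\<close>. Expanded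
  in the monomials \<open>X\<^sup>\<alpha>[1]\<close>, a discrete function becomes an ordinary formal power series with coefficients in
  the Clifford algebra, \<open>\<Delta>\<close> becomes the classical Laplacian \<open>\<Sum>\<^sub>j (\<partial>/\<partial>X\<^sub>j)\<^sup>2\<close>, and \<open>s\<close> multiplies the
  coefficients from the left by a constant. The vectors \<open>R\<^sub>j\<close> being rotated by conjugation with \<open>s\<close>,
  \<open>s\<inverse> \<xi> s = \<Sum>\<^sub>k R\<^sub>k Y\<^sub>k\<close> with \<open>Y = M X\<close> for an orthogonal matrix \<open>M\<close>, so that \<open>H\<^sup>0(s)\<close> is the
  substitution \<open>X \<mapsto> M X\<close>, under which the Laplacian is invariant.
\<close>

section \<open>Expansion in commuting variables\<close>

lemma ep_add_em: "ep j + em j = gen (Inl j)"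
  by (simp add: ep_def em_def flip: scaleR_add_right)

text \<open>The product \<open>e\<^sub>1^\<alpha>\<^sub>1 ... e\<^sub>m^\<alpha>\<^sub>m\<close>.
  Since every \<open>e\<^sub>j\<close> squares to 1, only the parities of the exponents matter, and
  \<open>rev_blade\<close>, the same product in reverse order, is its inverse.\<close>

definition blade :: "'m::{finite,linorder} multi \<Rightarrow> 'm clifford" where
  "blade \<alpha> = prod_list (map (\<lambda>i. gen (Inl i) ^ (\<alpha> $ i)) (sorted_list_of_set UNIV))"

definition rev_blade :: "'m::{finite,linorder} multi \<Rightarrow> 'm clifford" where
  "rev_blade \<alpha> = prod_list (map (\<lambda>i. gen (Inl i) ^ (\<alpha> $ i)) (rev (sorted_list_of_set UNIV)))"

lemma gen_power_square:
  fixes g :: "'m::{finite,linorder} + 'm"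
  shows "gen g ^ n * gen g ^ n = 1"
  by (metis gen_square mult_2 power2_eq_square power_add power_mult power_one)

lemma prod_list_involutions:
  fixes g :: "'a \<Rightarrow> 'b::monoid_mult"
  assumes "\<And>i. g i * g i = 1"
  shows "prod_list (map g l) * prod_list (map g (rev l)) = 1"
proof (induction l)
  case (Cons i l)
  have "prod_list (map g (i # l)) * prod_list (map g (rev (i # l))) =
      g i * (prod_list (map g l) * prod_list (map g (rev l))) * g i"
    by (simp add: mult.assoc)
  then show ?case by (simp add: Cons assms)
qed simp

lemma blade_rev_blade: "blade \<alpha> * rev_blade \<alpha> = 1" and rev_blade_blade: "rev_blade \<alpha> * blade \<alpha> = 1"
  using prod_list_involutions[of "\<lambda>i. gen (Inl i) ^ (\<alpha> $ i)" "sorted_list_of_set UNIV", OF gen_power_square]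
    prod_list_involutions[of "\<lambda>i. gen (Inl i) ^ (\<alpha> $ i)" "rev (sorted_list_of_set UNIV)", OF gen_power_square]
  by (simp_all add: blade_def rev_blade_def)

lemma rev_blade_0 [simp]: "rev_blade 0 = 1"
proof -
  have "prod_list (map (\<lambda>j. 1 :: 'a clifford) l) = 1" for l :: "'a list" by (induction l) simp_all
  then show ?thesis by (simp add: rev_blade_def del: rev_map)
qed

lemma gen_power_anticommute:
  fixes g h :: "'m::{finite,linorder} + 'm"
  assumes "g \<noteq> h"
  shows "gen g ^ n * gen h = (-1) ^ n * (gen h * gen g ^ n)"
proof (induction n)
  case (Suc n)
  have "gen g ^ Suc n * gen h = gen g * ((-1) ^ n * (gen h * gen g ^ n))"
    by (simp add: mult.assoc Suc)
  also have "\<dots> = (-1) ^ n * (gen g * gen h * gen g ^ n)"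
    by (simp only: minus_one_power_central[of "gen g"] mult.assoc)
  also have "\<dots> = (-1) ^ Suc n * (gen h * gen g ^ Suc n)"
    unfolding gen_anticommute[OF assms] by (simp add: mult.assoc)
  finally show ?case .
qed simp

text \<open>\<open>gen (Inl j)\<close> anticommutes with each factor, so the sign counts the factors
  with multiplicity.\<close>

lemma gen_prod_commute:
  fixes \<alpha> :: "'m::{finite,linorder} multi"
  assumes "j \<notin> set l"
  shows "prod_list (map (\<lambda>i. gen (Inl i) ^ (\<alpha> $ i)) l) * gen (Inl j) =
    (-1) ^ (\<Sum>i\<leftarrow>l. \<alpha> $ i) * (gen (Inl j) * prod_list (map (\<lambda>i. gen (Inl i) ^ (\<alpha> $ i)) l))"
  using assms
proof (induction l)
  case (Cons i l)
  let ?P = "prod_list (map (\<lambda>i. gen (Inl i :: 'm + 'm) ^ (\<alpha> $ i)) l)"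
  have ij: "(Inl i :: 'm + 'm) \<noteq> Inl j" using Cons.prems by auto
  have "gen (Inl i) ^ (\<alpha> $ i) * ?P * gen (Inl j) =
      gen (Inl i) ^ (\<alpha> $ i) * ((-1) ^ (\<Sum>i\<leftarrow>l. \<alpha> $ i) * (gen (Inl j) * ?P))"
    using Cons by (simp add: mult.assoc)
  also have "\<dots> = (-1) ^ (\<Sum>i\<leftarrow>l. \<alpha> $ i) * (gen (Inl i) ^ (\<alpha> $ i) * gen (Inl j) * ?P)"
    by (simp only: minus_one_power_central[of "gen (Inl i) ^ _"] mult.assoc)
  also have "\<dots> = (-1) ^ (\<Sum>i\<leftarrow>l. \<alpha> $ i) * ((-1) ^ (\<alpha> $ i) * (gen (Inl j) * (gen (Inl i) ^ (\<alpha> $ i) * ?P)))"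
    unfolding gen_power_anticommute[OF ij] by (simp only: mult.assoc)
  also have "\<dots> = (-1) ^ (\<alpha> $ i + (\<Sum>i\<leftarrow>l. \<alpha> $ i)) * (gen (Inl j) * (gen (Inl i) ^ (\<alpha> $ i) * ?P))"
    by (subst add.commute) (simp only: power_add mult.assoc)
  finally show ?case by simp
qed simp

text \<open>Isolates the power of \<open>e\<^sub>j\<close>: \<open>A\<close> collects the indices
  after j and \<open>B\<close> those before j, both in reverse order. Neither depends on the
  exponent at j, so one pair serves all \<beta> that agree with \<alpha> elsewhere. The signs of
  moving \<open>e\<^sub>j\<close> past \<open>B\<close> and \<open>A\<close> are the degrees of
  \<alpha> before and after j.\<close>

lemma rev_blade_split:
  fixes \<alpha> :: "'m::{finite,linorder} multi" and j :: 'm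
  obtains A B where
    "\<forall>\<beta>. (\<forall>i. i \<noteq> j \<longrightarrow> \<beta> $ i = \<alpha> $ i) \<longrightarrow> rev_blade \<beta> = A * gen (Inl j) ^ (\<beta> $ j) * B"
    "B * gen (Inl j) = (-1) ^ before_degree \<alpha> j * (gen (Inl j) * B)"
    "A * gen (Inl j) = (-1) ^ (multi_degree \<alpha> - before_degree \<alpha> j - \<alpha> $ j) * (gen (Inl j) * A)"
    "before_degree \<alpha> j + \<alpha> $ j \<le> multi_degree \<alpha>"
proof -
  obtain xs ys where L: "sorted_list_of_set (UNIV :: 'm set) = xs @ j # ys" "j \<notin> set xs" "j \<notin> set ys"
    "set xs = {..<j}" "distinct xs" by (rule explicit_poly_split)
  let ?P = "\<lambda>\<beta> l. prod_list (map (\<lambda>i. gen (Inl i :: 'm + 'm) ^ (\<beta> $ i)) l)"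
  have b: "before_degree \<alpha> j = (\<Sum>i\<leftarrow>xs. \<alpha> $ i)"
    using L by (simp add: before_degree_def sum_list_distinct_conv_sum_set)
  have "multi_degree \<alpha> = (\<Sum>i\<leftarrow>sorted_list_of_set UNIV. \<alpha> $ i)"
    by (subst sum_list_distinct_conv_sum_set) (simp_all add: multi_degree_def)
  then have d: "multi_degree \<alpha> = (\<Sum>i\<leftarrow>xs. \<alpha> $ i) + \<alpha> $ j + (\<Sum>i\<leftarrow>ys. \<alpha> $ i)" by (simp add: L(1))
  show ?thesis
  proof (rule that[of "?P \<alpha> (rev ys)" "?P \<alpha> (rev xs)"])
    show "\<forall>\<beta>. (\<forall>i. i \<noteq> j \<longrightarrow> \<beta> $ i = \<alpha> $ i) \<longrightarrow>
        rev_blade \<beta> = ?P \<alpha> (rev ys) * gen (Inl j) ^ (\<beta> $ j) * ?P \<alpha> (rev xs)"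
    proof (intro allI impI)
      fix \<beta> assume \<beta>: "\<forall>i. i \<noteq> j \<longrightarrow> \<beta> $ i = \<alpha> $ i"
      have "map (\<lambda>i. gen (Inl i :: 'm + 'm) ^ (\<beta> $ i)) (rev l) = map (\<lambda>i. gen (Inl i) ^ (\<alpha> $ i)) (rev l)"
        if "j \<notin> set l" for l
        using that \<beta> by (intro map_cong refl) (metis set_rev)
      note e = this[OF L(2)] this[OF L(3)]
      have "rev_blade \<beta> = ?P \<beta> (rev ys) * gen (Inl j) ^ (\<beta> $ j) * ?P \<beta> (rev xs)"
        by (simp add: rev_blade_def L(1) mult.assoc)
      then show "rev_blade \<beta> = ?P \<alpha> (rev ys) * gen (Inl j) ^ (\<beta> $ j) * ?P \<alpha> (rev xs)"
        unfolding e .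
    qed
    show "?P \<alpha> (rev xs) * gen (Inl j) = (-1) ^ before_degree \<alpha> j * (gen (Inl j) * ?P \<alpha> (rev xs))"
      using gen_prod_commute[of j "rev xs" \<alpha>] L(2) by (simp add: b rev_map[symmetric] sum_list_rev)
    show "?P \<alpha> (rev ys) * gen (Inl j) =
        (-1) ^ (multi_degree \<alpha> - before_degree \<alpha> j - \<alpha> $ j) * (gen (Inl j) * ?P \<alpha> (rev ys))"
      using gen_prod_commute[of j "rev ys" \<alpha>] L(3) by (simp add: b d rev_map[symmetric] sum_list_rev)
  qed (simp add: b d)
qed

text \<open>Two further factors \<open>e\<^sub>j\<close> stand next to each other and cancel. This
  is why second differences will not disturb the blade.\<close>

lemma rev_blade_add_2: "rev_blade (\<alpha> + axis j 1 + axis j 1) = rev_blade \<alpha>"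
proof -
  obtain A B where *: "\<forall>\<beta>. (\<forall>i. i \<noteq> j \<longrightarrow> \<beta> $ i = \<alpha> $ i) \<longrightarrow> rev_blade \<beta> = A * gen (Inl j) ^ (\<beta> $ j) * B"
    by (rule rev_blade_split[of j \<alpha>])
  have "gen (Inl j) ^ ((\<alpha> + axis j 1 + axis j 1) $ j) = gen (Inl j) ^ (\<alpha> $ j)"
    by (simp add: axis_def gen_square mult.assoc[symmetric])
  then show ?thesis by (subst (1 2) *[rule_format]) (simp_all add: axis_def)
qed

text \<open>Moving \<open>e\<^sub>j\<close> all the way to the left passes both \<open>B\<close> and
  \<open>A\<close>, but its own power freely. The resulting sign is the one in the definition of
  \<open>R_op\<close>.\<close>

lemma rev_blade_mult_gen:
  "rev_blade \<alpha> * gen (Inl j) = (-1) ^ (multi_degree \<alpha> - \<alpha> $ j) * (gen (Inl j) * rev_blade \<alpha>)"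
proof -
  let ?g = "gen (Inl j :: 'a + 'a)"
  obtain A B where s: "\<forall>\<beta>. (\<forall>i. i \<noteq> j \<longrightarrow> \<beta> $ i = \<alpha> $ i) \<longrightarrow> rev_blade \<beta> = A * ?g ^ (\<beta> $ j) * B"
    and B: "B * ?g = (-1) ^ before_degree \<alpha> j * (?g * B)"
    and A: "A * ?g = (-1) ^ (multi_degree \<alpha> - before_degree \<alpha> j - \<alpha> $ j) * (?g * A)"
    and le: "before_degree \<alpha> j + \<alpha> $ j \<le> multi_degree \<alpha>"
    by (rule rev_blade_split[of j \<alpha>])
  let ?b = "(-1 :: 'a clifford) ^ before_degree \<alpha> j"
  have "A * ?g ^ (\<alpha> $ j) * B * ?g = ?b * (A * ?g ^ (\<alpha> $ j) * ?g * B)"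
    by (simp only: mult.assoc B minus_one_power_central[of "?g ^ _"] minus_one_power_central[of A])
  also have "\<dots> = ?b * (A * ?g * ?g ^ (\<alpha> $ j) * B)"
    by (simp only: mult.assoc power_commutes[symmetric])
  also have "\<dots> = (?b * (-1) ^ (multi_degree \<alpha> - before_degree \<alpha> j - \<alpha> $ j)) * (?g * (A * ?g ^ (\<alpha> $ j) * B))"
    unfolding A by (simp only: mult.assoc)
  also have "?b * (-1) ^ (multi_degree \<alpha> - before_degree \<alpha> j - \<alpha> $ j) = (-1) ^ (multi_degree \<alpha> - \<alpha> $ j)"
    using le by (simp flip: power_add)
  finally show ?thesis by (simp add: s)
qed

text \<open>Here \<open>e\<^sub>j\<close> passes only \<open>B\<close> and then cancels one factor
  of its own power; the sign is the one in the definition of \<open>xi_op\<close>.\<close>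

lemma rev_blade_minus_axis:
  assumes "\<alpha> $ j \<noteq> 0"
  shows "rev_blade \<alpha> * gen (Inl j) = (-1) ^ before_degree \<alpha> j * rev_blade (\<alpha> - axis j 1)"
proof -
  let ?g = "gen (Inl j :: 'a + 'a)"
  obtain A B where s: "\<forall>\<beta>. (\<forall>i. i \<noteq> j \<longrightarrow> \<beta> $ i = \<alpha> $ i) \<longrightarrow> rev_blade \<beta> = A * ?g ^ (\<beta> $ j) * B"
    and B: "B * ?g = (-1) ^ before_degree \<alpha> j * (?g * B)"
    by (rule rev_blade_split[of j \<alpha>])
  obtain n where n: "\<alpha> $ j = Suc n" using assms by (cases "\<alpha> $ j") auto
  have "(\<alpha> - axis j 1) $ j = n" by (simp add: axis_def n)
  moreover have "?g ^ n * ?g * ?g = ?g ^ n" by (simp add: mult.assoc gen_square)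
  moreover have "rev_blade \<alpha> * ?g = A * ?g ^ Suc n * B * ?g" by (simp add: s n)
  moreover have "A * ?g ^ Suc n * B * ?g = (-1) ^ before_degree \<alpha> j * (A * (?g ^ n * ?g * ?g) * B)"
    by (simp only: mult.assoc B minus_one_power_central[of ?g] minus_one_power_central[of "?g ^ _"]
        minus_one_power_central[of A] power_Suc2)
  ultimately show ?thesis
    by (subst s[rule_format, of "\<alpha> - axis j 1"]) (simp_all add: axis_def mult.assoc del: power_Suc)
qed

section \<open>Power series in the commuting variables\<close>

text \<open>
  Since \<open>X\<^sup>\<alpha>[1] = \<xi>\<^sup>\<alpha>[1] rev_blade \<alpha>\<close>, this is the series \<open>\<Sum>\<^sub>\<alpha> X\<^sup>\<alpha>[1] a\<^sub>\<alpha>\<close>.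
\<close>

definition power_series :: "('m::{finite,linorder} multi \<Rightarrow> 'm clifford) \<Rightarrow> 'm dfun" where
  "power_series a = taylor_series (\<lambda>\<alpha>. rev_blade \<alpha> * a \<alpha>)"

lemma taylor_coeff_taylor_series: "taylor_coeff (taylor_series c) = c"
  using taylor_series_unique by metis

lemma taylor_coeff_power_series: "taylor_coeff (power_series a) = (\<lambda>\<alpha>. rev_blade \<alpha> * a \<alpha>)"
  by (simp add: power_series_def taylor_coeff_taylor_series)

text \<open>Every discrete function is such a series, because \<open>rev_blade \<alpha>\<close> is
  invertible with inverse \<open>blade \<alpha>\<close>.\<close>

lemma power_series_blade: "power_series (\<lambda>\<alpha>. blade \<alpha> * taylor_coeff f \<alpha>) = f"
proof -
  have "power_series (\<lambda>\<alpha>. blade \<alpha> * taylor_coeff f \<alpha>) = taylor_series (taylor_coeff f)"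
    by (simp add: power_series_def rev_blade_blade flip: mult.assoc)
  then show ?thesis using taylor_series_unique by metis
qed

lemma power_series_eq:
  assumes "\<forall>i. 2 * nat \<bar>x $ i\<bar> \<le> N"
  shows "power_series a x = (\<Sum>\<alpha>\<in>{\<alpha>. \<forall>i. \<alpha> $ i \<le> N}. basic_poly \<alpha> x * (rev_blade \<alpha> * a \<alpha>))"
  unfolding power_series_def using assms by (intro taylor_series_eq) blast

text \<open>At a fixed lattice point one bound N truncates all series to the same finite box of
  indices, which reduces the algebraic rules below to finite sums.\<close>

lemma ex_lattice_bound:
  fixes x :: "int ^ 'm::finite"
  obtains N where "\<forall>i. 2 * nat \<bar>x $ i\<bar> \<le> N"
proof
  show "\<forall>i. 2 * nat \<bar>x $ i\<bar> \<le> (\<Sum>i\<in>UNIV. 2 * nat \<bar>x $ i\<bar>)"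
    by (intro allI member_le_sum) simp_all
qed

lemma power_series_sum:
  "(\<Sum>j\<in>S. power_series (a j) x) = power_series (\<lambda>\<beta>. \<Sum>j\<in>S. a j \<beta>) x"
proof -
  obtain N where N: "\<forall>i. 2 * nat \<bar>x $ i\<bar> \<le> N" by (rule ex_lattice_bound[of x])
  show ?thesis
    unfolding power_series_eq[OF N] by (subst sum.swap) (simp add: sum_distrib_left)
qed

lemma power_series_add: "power_series a x + power_series b x = power_series (\<lambda>\<beta>. a \<beta> + b \<beta>) x"
proof -
  obtain N where N: "\<forall>i. 2 * nat \<bar>x $ i\<bar> \<le> N" by (rule ex_lattice_bound[of x])
  show ?thesis
    unfolding power_series_eq[OF N] by (simp add: distrib_left sum.distrib)
qed

lemma power_series_scaleR: "r *\<^sub>R power_series a x = power_series (\<lambda>\<beta>. r *\<^sub>R a \<beta>) x"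
proof -
  obtain N where N: "\<forall>i. 2 * nat \<bar>x $ i\<bar> \<le> N" by (rule ex_lattice_bound[of x])
  show ?thesis
    unfolding power_series_eq[OF N] by (simp add: scaleR_sum_right)
qed

lemma power_series_mult_right: "power_series a x * c = power_series (\<lambda>\<beta>. a \<beta> * c) x"
proof -
  obtain N where N: "\<forall>i. 2 * nat \<bar>x $ i\<bar> \<le> N" by (rule ex_lattice_bound[of x])
  show ?thesis
    unfolding power_series_eq[OF N] by (simp add: sum_distrib_right mult.assoc)
qed

lemma power_series_uminus: "- power_series a x = power_series (\<lambda>\<beta>. - a \<beta>) x"
  using power_series_scaleR[of "-1" a x] by simp

lemma power_series_one: "power_series (\<lambda>\<beta>. if \<beta> = 0 then 1 else 0) = (\<lambda>x. 1)"
proof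
  fix x
  have eq: "(\<lambda>\<alpha>. basic_poly \<alpha> x * (rev_blade \<alpha> * (if \<alpha> = 0 then 1 else 0))) =
      (\<lambda>\<alpha>. if \<alpha> = 0 then basic_poly \<alpha> x else (0 :: 'a clifford))" by (auto simp: fun_eq_iff)
  have "basic_poly 0 x = (1 :: 'a clifford)" by (metis is_basic_family_basic_poly is_basic_family_def)
  then show "power_series (\<lambda>\<beta>. if \<beta> = 0 then 1 else 0) x = (1 :: 'a clifford)"
    unfolding power_series_def taylor_series_def eq by simp
qed

section \<open>The operators on the level of coefficients\<close>

definition mul_var :: "'m::finite \<Rightarrow> (nat ^ 'm \<Rightarrow> 'v::zero) \<Rightarrow> nat ^ 'm \<Rightarrow> 'v" where
  "mul_var j a \<beta> = (if \<beta> $ j = 0 then 0 else a (\<beta> - axis j 1))"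

text \<open>On coefficients, \<open>mul_var j\<close> is multiplication by \<open>X\<^sub>j\<close>
  and \<open>formal_deriv j\<close> is the derivative with respect to \<open>X\<^sub>j\<close>. The
  coefficient type is left open because both Clifford and real coefficients occur.\<close>

definition formal_deriv :: "'m::finite \<Rightarrow> (nat ^ 'm \<Rightarrow> 'v::real_vector) \<Rightarrow> nat ^ 'm \<Rightarrow> 'v" where
  "formal_deriv j a \<beta> = real (\<beta> $ j + 1) *\<^sub>R a (\<beta> + axis j 1)"

lemma R_op_power_series: "R_op j (power_series a) = power_series (\<lambda>\<beta>. gen (Inl j) * a \<beta>)"
proof -
  have "taylor_coeff (R_op j (power_series a)) \<alpha> = taylor_coeff (power_series (\<lambda>\<beta>. gen (Inl j) * a \<beta>)) \<alpha>" for \<alpha>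
    unfolding taylor_coeff_R_op taylor_coeff_power_series ep_add_em mult.assoc[symmetric] rev_blade_mult_gen
    by (rule refl)
  then have "taylor_coeff (R_op j (power_series a)) = taylor_coeff (power_series (\<lambda>\<beta>. gen (Inl j) * a \<beta>))" by blast
  then show ?thesis by (metis taylor_series_unique)
qed

text \<open>The index is shifted by one unit in direction j. Indices with exponent 0 at j are not
  reached by the shift, and there \<open>mul_var\<close> is 0.\<close>

lemma xi_op_taylor_series:
  "xi_op j (taylor_series c) = taylor_series (\<lambda>\<beta>. (-1) ^ before_degree \<beta> j * mul_var j c \<beta>)"
proof
  fix x
  define g where "g \<alpha> = (-1) ^ before_degree \<alpha> j * basic_poly (\<alpha> + axis j 1) x * c \<alpha>" for \<alpha>
  define h where "h \<beta> = basic_poly \<beta> x * ((-1) ^ before_degree \<beta> j * mul_var j c \<beta>)" for \<beta>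
  have gh: "g \<alpha> = h (\<alpha> + axis j 1)" for \<alpha>
  proof -
    have "(\<alpha> + axis j 1) $ j \<noteq> 0" "\<alpha> + axis j 1 - axis j 1 = \<alpha>" by (simp_all add: axis_def)
    then show ?thesis
      by (simp add: g_def h_def mul_var_def before_degree_axis minus_one_power_central mult.assoc del: One_nat_def)
  qed
  have e: "\<beta> - axis j 1 + axis j 1 = \<beta>" if "h \<beta> \<noteq> 0" for \<beta>
    using that by (cases "\<beta> $ j = 0") (auto simp: h_def mul_var_def vec_eq_iff axis_def)
  have "Sum_any g = Sum_any h"
    unfolding Sum_any.expand_set
    by (rule sum.reindex_bij_witness[of _ "\<lambda>\<beta>. \<beta> - axis j 1" "\<lambda>\<alpha>. \<alpha> + axis j 1"])
      (auto simp: gh e simp del: One_nat_def)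
  then show "xi_op j (taylor_series c) x = taylor_series (\<lambda>\<beta>. (-1) ^ before_degree \<beta> j * mul_var j c \<beta>) x"
    by (simp add: xi_op_def termwise_def taylor_coeff_taylor_series)
      (simp add: taylor_series_def g_def h_def)
qed

text \<open>This is \<open>\<xi>\<^sub>j = R\<^sub>j X\<^sub>j\<close>: the sign of
  \<open>xi_op\<close> is absorbed when \<open>e\<^sub>j\<close> is moved into the blade.\<close>

lemma xi_op_power_series: "xi_op j (power_series a) = power_series (\<lambda>\<beta>. gen (Inl j) * mul_var j a \<beta>)"
proof -
  have "(-1) ^ before_degree \<beta> j * mul_var j (\<lambda>\<alpha>. rev_blade \<alpha> * a \<alpha>) \<beta> = rev_blade \<beta> * (gen (Inl j) * mul_var j a \<beta>)"
    for \<beta>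
    by (cases "\<beta> $ j = 0") (simp_all add: mul_var_def rev_blade_minus_axis flip: mult.assoc)
  then show ?thesis unfolding power_series_def xi_op_taylor_series by simp
qed

text \<open>The Laplacian is the sum of the squares of the \<open>partial_dirac j\<close>. Each of
  the two shifts in direction j carries the same sign, since the degree before j is unchanged, and
  the blade is restored by \<open>rev_blade_add_2\<close>.\<close>

lemma star_laplacian_power_series:
  "star_laplacian (power_series a) = power_series (\<lambda>\<beta>. \<Sum>j\<in>UNIV. formal_deriv j (formal_deriv j a) \<beta>)"
proof
  fix x
  have s: "(-1) ^ n * ((-1) ^ n * r) = (r :: real)" for n r by (cases "even n") simp_all
  have c: "coeff_shift j (coeff_shift j (\<lambda>\<alpha>. rev_blade \<alpha> * a \<alpha>)) =
      (\<lambda>\<beta>. rev_blade \<beta> * formal_deriv j (formal_deriv j a) \<beta>)" for j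
    by (rule ext) (simp add: coeff_shift_def formal_deriv_def before_degree_axis rev_blade_add_2 mult_ac s del: One_nat_def)
  have "star_laplacian (power_series a) x = (\<Sum>j\<in>UNIV. partial_dirac j (partial_dirac j (power_series a)) x)"
    by (simp add: star_laplacian_def partial_dirac_square)
  also have "\<dots> = (\<Sum>j\<in>UNIV. power_series (formal_deriv j (formal_deriv j a)) x)"
    by (simp add: power_series_def partial_dirac_taylor_series c)
  finally show "star_laplacian (power_series a) x = power_series (\<lambda>\<beta>. \<Sum>j\<in>UNIV. formal_deriv j (formal_deriv j a) \<beta>) x"
    by (simp add: power_series_sum)
qed

text \<open>Taylor coefficients are unique, and the invertible blade can be removed from
  them.\<close>

lemma power_series_eq_0_iff: "power_series a = (\<lambda>x. 0) \<longleftrightarrow> (\<forall>\<alpha>. a \<alpha> = 0)"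
proof -
  have zero: "taylor_series (\<lambda>\<alpha>. 0) = (\<lambda>x. 0 :: 'a clifford)" unfolding taylor_series_def mult_zero_right Sum_any.neutral by (rule refl)
  have "a \<alpha> = 0" if "power_series a = (\<lambda>x. 0)" for \<alpha>
  proof -
    have "rev_blade \<alpha> * a \<alpha> = 0"
      using that unfolding zero[symmetric] power_series_def by (rule taylor_series_inj)
    then have "blade \<alpha> * (rev_blade \<alpha> * a \<alpha>) = 0" by simp
    then show ?thesis by (simp add: blade_rev_blade flip: mult.assoc)
  qed
  then show ?thesis using zero by (auto simp: power_series_def)
qed

lemma discrete_harmonic_power_series:
  "discrete_harmonic (power_series a) \<longleftrightarrow> (\<forall>\<beta>. (\<Sum>j\<in>UNIV. formal_deriv j (formal_deriv j a) \<beta>) = 0)"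
  unfolding discrete_harmonic_def star_laplacian_power_series power_series_eq_0_iff by (rule refl)

section \<open>Orthogonal substitution in formal power series\<close>

text \<open>Multiplication by the linear form with coefficient vector w; \<open>deriv_lin v\<close>
  is the directional derivative along v.\<close>

definition mul_lin :: "real ^ 'm \<Rightarrow> (nat ^ 'm::finite \<Rightarrow> 'v::real_vector) \<Rightarrow> nat ^ 'm \<Rightarrow> 'v" where
  "mul_lin w a \<beta> = (\<Sum>j\<in>UNIV. (w $ j) *\<^sub>R mul_var j a \<beta>)"

definition deriv_lin :: "real ^ 'm \<Rightarrow> (nat ^ 'm::finite \<Rightarrow> 'v::real_vector) \<Rightarrow> nat ^ 'm \<Rightarrow> 'v" where
  "deriv_lin v a \<beta> = (\<Sum>i\<in>UNIV. (v $ i) *\<^sub>R formal_deriv i a \<beta>)"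

lemma formal_deriv_mul_var:
  "formal_deriv i (mul_var j a) \<beta> = mul_var j (formal_deriv i a) \<beta> + (if i = j then a \<beta> else 0)"
proof (cases "i = j")
  case True
  have 1: "formal_deriv j (mul_var j a) \<beta> = real (\<beta> $ j + 1) *\<^sub>R a \<beta>"
  proof -
    have "(\<beta> + axis j 1) $ j \<noteq> 0" "\<beta> + axis j 1 - axis j 1 = \<beta>" by (simp_all add: axis_def)
    then show ?thesis by (simp only: formal_deriv_def mul_var_def if_False)
  qed
  have 2: "mul_var j (formal_deriv j a) \<beta> = real (\<beta> $ j) *\<^sub>R a \<beta>"
  proof (cases "\<beta> $ j = 0")
    case False
    then have "(\<beta> - axis j 1) $ j + 1 = \<beta> $ j" "\<beta> - axis j 1 + axis j 1 = \<beta>"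
      by (auto simp: vec_eq_iff axis_def)
    then show ?thesis using False by (simp only: formal_deriv_def mul_var_def if_False)
  qed (simp add: mul_var_def)
  show ?thesis using True by (simp add: 1 2 scaleR_add_left)
next
  case False
  have "\<beta> + axis i 1 - axis j 1 = \<beta> - axis j 1 + axis i 1" if "\<beta> $ j \<noteq> 0"
    using that False by (auto simp: vec_eq_iff axis_def)
  then show ?thesis using False by (simp add: formal_deriv_def mul_var_def) (simp add: axis_def)
qed

text \<open>The canonical commutation relation, extended bilinearly from the coordinate
  directions.\<close>

lemma deriv_lin_mul_lin: "deriv_lin v (mul_lin w a) \<beta> = mul_lin w (deriv_lin v a) \<beta> + (v \<bullet> w) *\<^sub>R a \<beta>"
proof -
  have d: "formal_deriv i (mul_lin w a) \<beta> = (\<Sum>j\<in>UNIV. (w $ j) *\<^sub>R formal_deriv i (mul_var j a) \<beta>)" for i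
    by (simp add: formal_deriv_def mul_lin_def scaleR_sum_right mult.commute)
  have m: "mul_var j (deriv_lin v a) \<beta> = (\<Sum>i\<in>UNIV. (v $ i) *\<^sub>R mul_var j (formal_deriv i a) \<beta>)" for j
    by (simp add: mul_var_def deriv_lin_def)
  have "deriv_lin v (mul_lin w a) \<beta> =
      (\<Sum>i\<in>UNIV. \<Sum>j\<in>UNIV. (v $ i * w $ j) *\<^sub>R mul_var j (formal_deriv i a) \<beta>) +
      (\<Sum>i\<in>UNIV. \<Sum>j\<in>UNIV. (v $ i * w $ j) *\<^sub>R (if i = j then a \<beta> else 0))"
    by (simp add: deriv_lin_def d formal_deriv_mul_var scaleR_sum_right scaleR_add_right sum.distrib)
  also have "(\<Sum>i\<in>UNIV. \<Sum>j\<in>UNIV. (v $ i * w $ j) *\<^sub>R (if i = j then a \<beta> else 0)) = (v \<bullet> w) *\<^sub>R a \<beta>"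
    by (simp add: inner_vec_def scaleR_sum_left if_distrib cong: if_cong)
  also have "(\<Sum>i\<in>UNIV. \<Sum>j\<in>UNIV. (v $ i * w $ j) *\<^sub>R mul_var j (formal_deriv i a) \<beta>) = mul_lin w (deriv_lin v a) \<beta>"
    by (subst sum.swap) (simp add: mul_lin_def m scaleR_sum_right mult.commute)
  finally show ?thesis .
qed

lemma mul_lin_scaleR: "mul_lin w (\<lambda>\<beta>. r *\<^sub>R a \<beta>) = (\<lambda>\<beta>. r *\<^sub>R mul_lin w a \<beta>)"
proof -
  have "mul_var j (\<lambda>\<beta>. r *\<^sub>R a \<beta>) \<beta> = r *\<^sub>R mul_var j a \<beta>" for j \<beta> by (simp add: mul_var_def)
  then show ?thesis by (simp add: mul_lin_def fun_eq_iff scaleR_sum_right mult.commute)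
qed

lemma mul_lin_add: "mul_lin w (\<lambda>\<beta>. a \<beta> + b \<beta>) = (\<lambda>\<beta>. mul_lin w a \<beta> + mul_lin w b \<beta>)"
proof -
  have "mul_var j (\<lambda>\<beta>. a \<beta> + b \<beta>) \<beta> = mul_var j a \<beta> + mul_var j b \<beta>" for j \<beta>
    by (simp add: mul_var_def)
  then show ?thesis by (simp add: mul_lin_def fun_eq_iff scaleR_add_right sum.distrib)
qed

text \<open>The Leibniz rule, by iterating the commutation relation. For n = 0 the truncated
  exponent is harmless, its coefficient being 0.\<close>

lemma deriv_lin_mul_lin_power:
  fixes a :: "nat ^ 'a::finite \<Rightarrow> 'b::real_vector"
  shows "deriv_lin v ((mul_lin w ^^ n) a) \<beta> =
    (mul_lin w ^^ n) (deriv_lin v a) \<beta> + (real n * (v \<bullet> w)) *\<^sub>R (mul_lin w ^^ (n - 1)) a \<beta>"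
proof (induction n arbitrary: \<beta>)
  case (Suc n)
  have "deriv_lin v ((mul_lin w ^^ n) a) =
      (\<lambda>\<beta>. (mul_lin w ^^ n) (deriv_lin v a) \<beta> + (real n * (v \<bullet> w)) *\<^sub>R (mul_lin w ^^ (n - 1)) a \<beta>)"
    using Suc by blast
  moreover have d: "(r * 2) *\<^sub>R y = r *\<^sub>R y + r *\<^sub>R y" for r and y :: 'b
    by (metis mult_2_right scaleR_add_left)
  ultimately show ?case
    by (cases n) (simp_all add: deriv_lin_mul_lin mul_lin_add mul_lin_scaleR algebra_simps d)
qed simp

section \<open>Linear substitution in monomials and in series\<close>

text \<open>\<open>subst_coeff M \<alpha> \<beta>\<close> is the coefficient of \<open>X\<^sup>\<beta>\<close> in \<open>(M X)\<^sup>\<alpha>\<close>.\<close>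

definition subst_coeff :: "real ^ 'm::{finite,linorder} ^ 'm::{finite,linorder} \<Rightarrow> 'm::{finite,linorder} multi \<Rightarrow> 'm multi \<Rightarrow> real" where
  "subst_coeff M \<alpha> = foldr (\<lambda>k. mul_lin (M $ k) ^^ (\<alpha> $ k)) (sorted_list_of_set UNIV) (\<lambda>\<beta>. if \<beta> = 0 then 1 else 0)"

lemma mul_lin_power_scaleR: "(mul_lin w ^^ n) (\<lambda>\<beta>. r *\<^sub>R a \<beta>) = (\<lambda>\<beta>. r *\<^sub>R (mul_lin w ^^ n) a \<beta>)"
  by (induction n) (simp_all add: mul_lin_scaleR)

lemma foldr_mul_lin_scaleR:
  "foldr (\<lambda>k. mul_lin (M $ k) ^^ (\<alpha> $ k)) l (\<lambda>\<beta>. r *\<^sub>R a \<beta>) =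
    (\<lambda>\<beta>. r *\<^sub>R foldr (\<lambda>k. mul_lin (M $ k) ^^ (\<alpha> $ k)) l a \<beta>)"
  by (induction l) (simp_all add: mul_lin_power_scaleR)

lemma deriv_lin_foldr:
  fixes M :: "real ^ 'm ^ 'm::finite"
  assumes "\<And>i. i \<in> set l \<Longrightarrow> v \<bullet> M $ i = 0"
  shows "deriv_lin v (foldr (\<lambda>k. mul_lin (M $ k) ^^ (\<alpha> $ k)) l a) = foldr (\<lambda>k. mul_lin (M $ k) ^^ (\<alpha> $ k)) l (deriv_lin v a)"
  using assms
proof (induction l)
  case (Cons i l)
  then show ?case by (simp add: deriv_lin_mul_lin_power fun_eq_iff flip: Cons.IH)
qed simp

text \<open>The derivative along row k passes every factor belonging to another row, by
  orthogonality, and acts on the power of the k-th linear form as an ordinary derivative, since the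
  row has norm 1.\<close>

lemma deriv_lin_subst_coeff:
  fixes M :: "real ^ 'm::{finite,linorder} ^ 'm::{finite,linorder}"
  assumes "\<And>i j. M $ i \<bullet> M $ j = (if i = j then 1 else 0)"
  shows "deriv_lin (M $ k) (subst_coeff M \<alpha>) \<beta> = real (\<alpha> $ k) * subst_coeff M (\<alpha> - axis k 1) \<beta>"
proof -
  obtain xs ys where L: "sorted_list_of_set (UNIV :: 'm set) = xs @ k # ys" "k \<notin> set xs" "k \<notin> set ys"
    by (rule explicit_poly_split)
  let ?F = "\<lambda>\<alpha>. foldr (\<lambda>k. mul_lin (M $ k) ^^ (\<alpha> $ k))"
  let ?d = "\<lambda>\<beta>::'m multi. if \<beta> = 0 then 1 else 0 :: real"
  have z: "M $ k \<bullet> M $ i = 0" if "i \<in> set xs \<or> i \<in> set ys" for i using that L assms[of k i] by auto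
  have d: "deriv_lin (M $ k) ?d = (\<lambda>\<beta>. 0)"
    by (auto simp: deriv_lin_def formal_deriv_def fun_eq_iff vec_eq_iff axis_def intro!: sum.neutral)
  have F: "?F (\<alpha> - axis k 1) l g = ?F \<alpha> l g" if "k \<notin> set l" for l and g :: "'m multi \<Rightarrow> real"
    using that by (intro foldr_cong) (auto simp: axis_def)
  \<comment> \<open>Homogeneity with the scalar 0 gives the values at the zero series.\<close>
  have zero: "?F \<alpha> ys (\<lambda>\<beta>. 0) = (\<lambda>\<beta>. 0 :: real)" "(mul_lin (M $ k) ^^ n) (\<lambda>\<beta>. 0) = (\<lambda>\<beta>. 0 :: real)" for n
    using foldr_mul_lin_scaleR[where M = M and \<alpha> = \<alpha> and l = ys and r = 0 and a = "\<lambda>\<beta>. 0 :: real"]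
      mul_lin_power_scaleR[where w = "M $ k" and n = n and r = 0 and a = "\<lambda>\<beta>. 0 :: real"]
    by simp_all
  have "deriv_lin (M $ k) (subst_coeff M \<alpha>) \<beta> =
      ?F \<alpha> xs (deriv_lin (M $ k) ((mul_lin (M $ k) ^^ (\<alpha> $ k)) (?F \<alpha> ys ?d))) \<beta>"
    by (simp add: subst_coeff_def L(1) deriv_lin_foldr z)
  also have "deriv_lin (M $ k) ((mul_lin (M $ k) ^^ (\<alpha> $ k)) (?F \<alpha> ys ?d)) =
      (\<lambda>\<beta>. real (\<alpha> $ k) *\<^sub>R (mul_lin (M $ k) ^^ (\<alpha> $ k - 1)) (?F \<alpha> ys ?d) \<beta>)"
  proof -
    \<comment> \<open>The derivative passes the factors in \<open>ys\<close> as well and finally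
      meets the constant series 1, which it annihilates.\<close>
    have "deriv_lin (M $ k) (?F \<alpha> ys ?d) = (\<lambda>\<beta>. 0)" by (simp add: deriv_lin_foldr z d zero)
    then show ?thesis by (intro ext) (simp add: deriv_lin_mul_lin_power zero assms)
  qed
  also have "?F \<alpha> xs \<dots> \<beta> = real (\<alpha> $ k) * subst_coeff M (\<alpha> - axis k 1) \<beta>"
  proof -
    have "(\<alpha> - axis k 1) $ k = \<alpha> $ k - 1" by (simp add: axis_def)
    then show ?thesis
      unfolding foldr_mul_lin_scaleR by (simp add: subst_coeff_def L(1) F L(2,3) del: One_nat_def vector_minus_component)
  qed
  finally show ?thesis .
qed

lemma multi_degree_axis: "multi_degree (\<alpha> + axis j 1) = multi_degree \<alpha> + 1"
  by (simp add: multi_degree_def sum.distrib axis_def)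

text \<open>A product of |\<alpha>| linear forms is homogeneous of degree |\<alpha>|;
  \<open>hom n\<close> expresses homogeneity of degree n, which each \<open>mul_lin\<close> raises
  by one.\<close>

lemma subst_coeff_eq_0:
  assumes "multi_degree \<alpha> \<noteq> multi_degree \<beta>"
  shows "subst_coeff M \<alpha> \<beta> = 0"
proof -
  define hom where "hom n a \<longleftrightarrow> (\<forall>\<beta>. multi_degree \<beta> \<noteq> n \<longrightarrow> a \<beta> = 0)" for n and a :: "'a multi \<Rightarrow> real"
  have v: "hom (Suc n) (mul_var j a)" if "hom n a" for n j a
    unfolding hom_def
  proof (intro allI impI)
    fix \<beta> :: "'a multi" assume b: "multi_degree \<beta> \<noteq> Suc n"
    show "mul_var j a \<beta> = 0"
    proof (cases "\<beta> $ j = 0")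
      case False
      then have "\<beta> - axis j 1 + axis j 1 = \<beta>" by (auto simp: vec_eq_iff axis_def)
      then have "multi_degree (\<beta> - axis j 1) \<noteq> n" using b multi_degree_axis[of "\<beta> - axis j 1" j] by simp
      then show ?thesis using that by (simp add: hom_def mul_var_def)
    qed (simp add: mul_var_def)
  qed
  then have l: "hom (Suc n) (mul_lin w a)" if "hom n a" for n w a
    using that by (auto simp: hom_def mul_lin_def intro!: sum.neutral)
  have p: "hom (k + n) ((mul_lin w ^^ k) a)" if "hom n a" for k n w a
    using that by (induction k) (auto intro: l)
  have d: "hom 0 (\<lambda>\<beta>. if \<beta> = 0 then 1 else 0)"
    by (auto simp: hom_def multi_degree_def)
  have "hom (\<Sum>k\<leftarrow>xs. \<alpha> $ k) (foldr (\<lambda>k. mul_lin (M $ k) ^^ (\<alpha> $ k)) xs (\<lambda>\<beta>. if \<beta> = 0 then 1 else 0))" for xs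
    by (induction xs) (auto intro: p d)
  from this[of "sorted_list_of_set UNIV"] show ?thesis
    using assms by (simp add: hom_def subst_coeff_def multi_degree_def sum_list_distinct_conv_sum_set)
qed

text \<open>The coefficient of \<open>X^\<beta>\<close> after substituting M X for X. By homogeneity
  only indices of the degree of \<beta> contribute, so the sum is finite even for an infinite
  series.\<close>

definition linear_subst ::
    "real ^ 'm::{finite,linorder} ^ 'm::{finite,linorder} \<Rightarrow> ('m::{finite,linorder} multi \<Rightarrow> 'v::real_vector) \<Rightarrow> 'm multi \<Rightarrow> 'v" where
  "linear_subst M a \<beta> = (\<Sum>\<alpha> | multi_degree \<alpha> = multi_degree \<beta>. subst_coeff M \<alpha> \<beta> *\<^sub>R a \<alpha>)"

lemma finite_multi_degree: "finite {\<alpha> :: 'm::{finite,linorder} multi. multi_degree \<alpha> = n}"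
  by (rule finite_subset[OF _ finite_multi_le[of n]])
    (auto simp: multi_degree_def intro!: member_le_sum)

text \<open>The chain rule for orthonormal rows: the derivative along row k after the substitution
  is the k-th partial derivative before it.\<close>

lemma deriv_lin_linear_subst:
  fixes M :: "real ^ 'm::{finite,linorder} ^ 'm::{finite,linorder}"
  assumes "\<And>i j. M $ i \<bullet> M $ j = (if i = j then 1 else 0)"
  shows "deriv_lin (M $ k) (linear_subst M a) = linear_subst M (formal_deriv k a)"
proof
  fix \<beta> :: "'m multi"
  let ?A = "{\<alpha> :: 'm multi. multi_degree \<alpha> = multi_degree \<beta> + 1}" and ?B = "{\<alpha> :: 'm multi. multi_degree \<alpha> = multi_degree \<beta>}"
  \<comment> \<open>Raising \<beta> in any direction gives degree |\<beta>| + 1, so all partial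
    derivatives are sums over the same set \<open>?A\<close> and the summations can be
    interchanged.\<close>
  have "deriv_lin (M $ k) (linear_subst M a) \<beta> = (\<Sum>\<alpha>\<in>?A. deriv_lin (M $ k) (subst_coeff M \<alpha>) \<beta> *\<^sub>R a \<alpha>)"
    unfolding deriv_lin_def formal_deriv_def linear_subst_def multi_degree_axis scaleR_sum_right scaleR_sum_left
    by (subst sum.swap) simp
  also have "\<dots> = (\<Sum>\<alpha>\<in>?A. (real (\<alpha> $ k) * subst_coeff M (\<alpha> - axis k 1) \<beta>) *\<^sub>R a \<alpha>)"
    by (simp add: deriv_lin_subst_coeff[OF assms])
  \<comment> \<open>An index outside the image has exponent 0 at k, and its term carries this
    exponent as a factor.\<close>
  also have "\<dots> = (\<Sum>\<alpha>\<in>(\<lambda>\<gamma>. \<gamma> + axis k 1) ` ?B. (real (\<alpha> $ k) * subst_coeff M (\<alpha> - axis k 1) \<beta>) *\<^sub>R a \<alpha>)"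
  proof (rule sum.mono_neutral_right)
    show "\<forall>\<alpha>\<in>?A - (\<lambda>\<gamma>. \<gamma> + axis k 1) ` ?B. (real (\<alpha> $ k) * subst_coeff M (\<alpha> - axis k 1) \<beta>) *\<^sub>R a \<alpha> = 0"
    proof
      fix \<alpha> assume \<alpha>: "\<alpha> \<in> ?A - (\<lambda>\<gamma>. \<gamma> + axis k 1) ` ?B"
      have "\<alpha> $ k = 0"
      proof (rule ccontr)
        assume "\<alpha> $ k \<noteq> 0"
        then have e: "\<alpha> = \<alpha> - axis k 1 + axis k 1" by (auto simp: vec_eq_iff axis_def)
        then have "\<alpha> - axis k 1 \<in> ?B" using \<alpha> multi_degree_axis[of "\<alpha> - axis k 1" k] by simp
        then show False using \<alpha> e by blast
      qed
      then show "(real (\<alpha> $ k) * subst_coeff M (\<alpha> - axis k 1) \<beta>) *\<^sub>R a \<alpha> = 0" by simp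
    qed
  qed (use finite_multi_degree in \<open>auto simp: multi_degree_axis simp del: One_nat_def\<close>)
  also have "\<dots> = (\<Sum>\<gamma>\<in>?B. (real (\<gamma> $ k + 1) * subst_coeff M \<gamma> \<beta>) *\<^sub>R a (\<gamma> + axis k 1))"
    by (subst sum.reindex) (auto simp: inj_on_def axis_def intro!: sum.cong)
  also have "\<dots> = linear_subst M (formal_deriv k a) \<beta>"
    by (simp add: linear_subst_def formal_deriv_def mult.commute)
  finally show "deriv_lin (M $ k) (linear_subst M a) \<beta> = linear_subst M (formal_deriv k a) \<beta>" .
qed

text \<open>The Laplacian may be computed in the frame of the rows: expanding the squares leaves the
  inner products of the columns of M, which are orthonormal.\<close>

lemma sum_deriv_lin_rows:
  fixes M :: "real ^ 'm::finite ^ 'm"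
  assumes "transpose M ** M = mat 1"
  shows "(\<Sum>k\<in>UNIV. deriv_lin (M $ k) (deriv_lin (M $ k) a) \<beta>) = (\<Sum>j\<in>UNIV. formal_deriv j (formal_deriv j a) \<beta>)"
proof -
  have o: "(\<Sum>k\<in>UNIV. M $ k $ i * M $ k $ j) = (if i = j then 1 else 0)" for i j
  proof -
    have "(transpose M ** M) $ i $ j = (if i = j then 1 else 0)" by (simp add: assms mat_def)
    then show ?thesis by (simp add: matrix_matrix_mult_def transpose_def)
  qed
  have "deriv_lin v (deriv_lin v a) \<beta> = (\<Sum>i\<in>UNIV. \<Sum>j\<in>UNIV. (v $ i * v $ j) *\<^sub>R formal_deriv i (formal_deriv j a) \<beta>)" for v
    by (simp add: deriv_lin_def formal_deriv_def scaleR_sum_right mult_ac)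
  then have "(\<Sum>k\<in>UNIV. deriv_lin (M $ k) (deriv_lin (M $ k) a) \<beta>) =
      (\<Sum>k\<in>UNIV. \<Sum>i\<in>UNIV. \<Sum>j\<in>UNIV. (M $ k $ i * M $ k $ j) *\<^sub>R formal_deriv i (formal_deriv j a) \<beta>)"
    by simp
  also have "\<dots> = (\<Sum>i\<in>UNIV. \<Sum>k\<in>UNIV. \<Sum>j\<in>UNIV. (M $ k $ i * M $ k $ j) *\<^sub>R formal_deriv i (formal_deriv j a) \<beta>)"
    by (rule sum.swap)
  also have "\<dots> = (\<Sum>i\<in>UNIV. \<Sum>j\<in>UNIV. \<Sum>k\<in>UNIV. (M $ k $ i * M $ k $ j) *\<^sub>R formal_deriv i (formal_deriv j a) \<beta>)"
    by (intro sum.cong refl sum.swap)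
  also have "\<dots> = (\<Sum>i\<in>UNIV. \<Sum>j\<in>UNIV. if i = j then formal_deriv i (formal_deriv j a) \<beta> else 0)"
    by (intro sum.cong refl) (simp add: o flip: scaleR_sum_left)
  finally show ?thesis by simp
qed

text \<open>Orthonormal columns turn the Laplacian into the sum of squared row derivatives;
  orthonormal rows give the chain rule, which carries these through the substitution.\<close>

lemma laplacian_linear_subst:
  fixes M :: "real ^ 'm::{finite,linorder} ^ 'm::{finite,linorder}"
  assumes M: "orthogonal_matrix M"
    and a: "\<And>\<beta>. (\<Sum>j\<in>UNIV. formal_deriv j (formal_deriv j a) \<beta>) = 0"
  shows "(\<Sum>j\<in>UNIV. formal_deriv j (formal_deriv j (linear_subst M a)) \<beta>) = 0"
proof -
  have "(M ** transpose M) $ i $ j = (if i = j then 1 else 0)" for i j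
    using M by (simp add: orthogonal_matrix_def mat_def)
  then have "M $ i \<bullet> M $ j = (if i = j then 1 else 0)" for i j
    by (simp add: matrix_matrix_mult_def transpose_def inner_vec_def)
  note d = deriv_lin_linear_subst[OF this]
  have "transpose M ** M = mat 1" using M by (simp add: orthogonal_matrix_def)
  note sum_deriv_lin_rows[OF this, of "linear_subst M a" \<beta>, symmetric]
  also have "(\<Sum>k\<in>UNIV. deriv_lin (M $ k) (deriv_lin (M $ k) (linear_subst M a)) \<beta>) =
      linear_subst M (\<lambda>\<beta>. \<Sum>k\<in>UNIV. formal_deriv k (formal_deriv k a) \<beta>) \<beta>"
    unfolding d by (simp add: linear_subst_def scaleR_sum_right) (rule sum.swap)
  also have "\<dots> = 0" by (simp add: a linear_subst_def)
  finally show ?thesis .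
qed

section \<open>The action of the spin group\<close>

definition clifford_vec :: "real ^ 'm::{finite,linorder} \<Rightarrow> 'm::{finite,linorder} clifford" where
  "clifford_vec v = (\<Sum>j\<in>UNIV. (v $ j) *\<^sub>R gen (Inl j))"

lemma clifford_vec_anticommute: "clifford_vec v * clifford_vec w + clifford_vec w * clifford_vec v = (2 * (v \<bullet> w)) *\<^sub>R 1"
proof -
  have g: "gen (Inl i) * gen (Inl j) + gen (Inl j) * gen (Inl i) = (if i = j then 2 *\<^sub>R (1 :: 'a clifford) else 0)" for i j :: 'a
    using gen_anticommute[of "Inl i" "Inl j :: 'a + 'a"] by (auto simp: gen_square scaleR_2)
  have "clifford_vec v * clifford_vec w + clifford_vec w * clifford_vec v =
      (\<Sum>i\<in>UNIV. \<Sum>j\<in>UNIV. (v $ i * w $ j) *\<^sub>R (gen (Inl i) * gen (Inl j))) +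
      (\<Sum>i\<in>UNIV. \<Sum>j\<in>UNIV. (v $ i * w $ j) *\<^sub>R (gen (Inl j) * gen (Inl i)))"
    unfolding clifford_vec_def sum_product
    by (subst (2) sum.swap) (simp add: mult.commute)
  also have "\<dots> = (\<Sum>i\<in>UNIV. \<Sum>j\<in>UNIV. (v $ i * w $ j) *\<^sub>R (if i = j then 2 *\<^sub>R 1 else 0))"
    by (simp only: g flip: sum.distrib scaleR_add_right)
  also have "\<dots> = (2 * (v \<bullet> w)) *\<^sub>R 1"
    by (simp add: inner_vec_def sum_distrib_left scaleR_sum_left if_distrib mult_ac cong: if_cong)
  finally show ?thesis .
qed

lemma clifford_vec_square: "clifford_vec v * clifford_vec v = (v \<bullet> v) *\<^sub>R 1"
proof -
  have "2 *\<^sub>R (clifford_vec v * clifford_vec v) = 2 *\<^sub>R ((v \<bullet> v) *\<^sub>R 1)"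
    using clifford_vec_anticommute[of v v] by (simp add: scaleR_2 flip: scaleR_add_left)
  then show ?thesis by (simp only: scaleR_cancel_left) simp
qed

lemma linear_clifford_vec: "linear clifford_vec"
  by (rule linearI) (simp_all add: clifford_vec_def scaleR_add_left sum.distrib scaleR_sum_right)

text \<open>The anticommutation rule moves one w past v, and the square of w is 1. The result is the
  reflection in the hyperplane orthogonal to w.\<close>

lemma clifford_vec_reflection:
  assumes "norm w = 1"
  shows "- clifford_vec w * clifford_vec v * clifford_vec w = clifford_vec (v - (2 * (v \<bullet> w)) *\<^sub>R w)"
proof -
  have 1: "clifford_vec w * clifford_vec w = 1"
    using assms by (simp add: clifford_vec_square flip: power2_norm_eq_inner)
  have 2: "- clifford_vec w * clifford_vec v = clifford_vec v * clifford_vec w - (2 * (v \<bullet> w)) *\<^sub>R 1"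
    unfolding clifford_vec_anticommute[symmetric] by simp
  have "- clifford_vec w * clifford_vec v * clifford_vec w =
      clifford_vec v * (clifford_vec w * clifford_vec w) - (2 * (v \<bullet> w)) *\<^sub>R clifford_vec w"
    unfolding 2 by (simp add: left_diff_distrib mult.assoc)
  then show ?thesis
    by (simp add: 1 linear_diff[OF linear_clifford_vec] linear_cmul[OF linear_clifford_vec])
qed

lemma orthogonal_transformation_unit_reflection:
  fixes w :: "'a::euclidean_space"
  assumes "norm w = 1"
  shows "orthogonal_transformation (\<lambda>v. v - (2 * (v \<bullet> w)) *\<^sub>R w)"
  unfolding orthogonal_transformation_def
proof (intro conjI allI linearI)
  have "w \<bullet> w = 1" using assms by (simp flip: power2_norm_eq_inner)
  then show "(v - (2 * (v \<bullet> w)) *\<^sub>R w) \<bullet> (u - (2 * (u \<bullet> w)) *\<^sub>R w) = v \<bullet> u" for u v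
    by (simp add: algebra_simps inner_commute)
qed (simp_all add: algebra_simps inner_commute)

section \<open>Spin elements as left multiplications of coefficients\<close>

lemma vector_op_power_series: "vector_op \<omega> (power_series a) = power_series (\<lambda>\<beta>. clifford_vec \<omega> * a \<beta>)"
  unfolding vector_op_def R_op_power_series power_series_scaleR power_series_sum clifford_vec_def
  by (simp add: sum_distrib_right)

lemma vector_sphereE:
  assumes "w \<in> vector_sphere"
  obtains \<omega> where "w = vector_op \<omega>" "norm \<omega> = 1"
proof -
  obtain \<omega> where w: "w = vector_op \<omega>" "w \<circ> w = id" using assms by (auto simp: vector_sphere_def)
  \<comment> \<open>The operator identity is tested on the constant function 1, where
    \<open>w \<circ> w\<close> is multiplication by the squared norm of \<omega>.\<close>
  have "(\<lambda>x. 1) = w (w (\<lambda>x. 1))" using w(2) by (simp add: fun_eq_iff)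
  also have "\<dots> = (\<lambda>x. (\<omega> \<bullet> \<omega>) *\<^sub>R 1)"
    unfolding w(1) power_series_one[symmetric] vector_op_power_series mult.assoc[symmetric] clifford_vec_square
    by (rule ext) (simp add: power_series_one flip: power_series_scaleR)
  finally have "(1 :: 'a clifford) = (\<omega> \<bullet> \<omega>) *\<^sub>R 1" by metis
  then have "(1 - \<omega> \<bullet> \<omega>) *\<^sub>R (1 :: 'a clifford) = 0" by (simp add: scaleR_diff_left)
  then have "norm \<omega> = 1" by (simp add: norm_eq_sqrt_inner)
  then show ?thesis using that w(1) by blast
qed

text \<open>By induction along the product: each factor contributes one reflection to the
  conjugation of vectors, and \<open>L\<close> is the composition of these reflections.\<close>

lemma op_prod_power_series:
  assumes "set ws \<subseteq> vector_sphere"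
  obtains u u' L where "\<And>a. op_prod ws (power_series a) = power_series (\<lambda>\<beta>. u * a \<beta>)"
    "\<And>a. op_prod (map op_neg (rev ws)) (power_series a) = power_series (\<lambda>\<beta>. u' * a \<beta>)"
    "orthogonal_transformation L" "\<And>v. u' * clifford_vec v * u = clifford_vec (L v)"
  using assms
proof (induction ws arbitrary: thesis)
  case Nil
  show ?case by (rule Nil(1)[of 1 1 id]) (simp_all add: op_prod_def orthogonal_transformation_def)
next
  case (Cons w ws)
  from Cons.prems(2) have ws: "set ws \<subseteq> vector_sphere" and w: "w \<in> vector_sphere" by auto
  obtain u u' L where IH: "\<And>a. op_prod ws (power_series a) = power_series (\<lambda>\<beta>. u * a \<beta>)"
    "\<And>a. op_prod (map op_neg (rev ws)) (power_series a) = power_series (\<lambda>\<beta>. u' * a \<beta>)"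
    "orthogonal_transformation L" "\<And>v. u' * clifford_vec v * u = clifford_vec (L v)"
    using Cons.IH[OF _ ws] by blast
  obtain \<omega> where \<omega>: "w = vector_op \<omega>" "norm \<omega> = 1" using w by (rule vector_sphereE)
  have n: "op_neg w (power_series a) = power_series (\<lambda>\<beta>. - clifford_vec \<omega> * a \<beta>)" for a
    unfolding op_neg_def \<omega>(1) vector_op_power_series by (simp add: power_series_uminus)
  show ?case
  \<comment> \<open>The new factor is outermost in the product but acts first in its conjugate, so
    in the conjugated vector it stands innermost: its reflection is applied before
    \<open>L\<close>.\<close>
  proof (rule Cons.prems(1)[of "clifford_vec \<omega> * u" "u' * - clifford_vec \<omega>"
        "L \<circ> (\<lambda>v. v - (2 * (v \<bullet> \<omega>)) *\<^sub>R \<omega>)"])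
    have "op_prod (w # ws) f = w (op_prod ws f)" for f by (simp add: op_prod_def)
    then show "op_prod (w # ws) (power_series a) = power_series (\<lambda>\<beta>. clifford_vec \<omega> * u * a \<beta>)" for a
      by (simp add: IH \<omega>(1) vector_op_power_series mult.assoc)
    have "op_prod (map op_neg (rev (w # ws))) f = op_prod (map op_neg (rev ws)) (op_neg w f)" for f
      by (simp add: op_prod_append) (simp add: op_prod_def)
    then show "op_prod (map op_neg (rev (w # ws))) (power_series a) = power_series (\<lambda>\<beta>. u' * - clifford_vec \<omega> * a \<beta>)" for a
      by (simp add: IH n mult.assoc)
    show "orthogonal_transformation (L \<circ> (\<lambda>v. v - (2 * (v \<bullet> \<omega>)) *\<^sub>R \<omega>))"
      by (intro orthogonal_transformation_compose IH orthogonal_transformation_unit_reflection \<omega>)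
    show "u' * - clifford_vec \<omega> * clifford_vec v * (clifford_vec \<omega> * u) =
        clifford_vec ((L \<circ> (\<lambda>v. v - (2 * (v \<bullet> \<omega>)) *\<^sub>R \<omega>)) v)" for v
    proof -
      have "u' * - clifford_vec \<omega> * clifford_vec v * (clifford_vec \<omega> * u) =
          u' * (- clifford_vec \<omega> * clifford_vec v * clifford_vec \<omega>) * u"
        by (simp only: mult.assoc)
      then show ?thesis by (simp only: clifford_vec_reflection[OF \<omega>(2)] IH o_def)
    qed
  qed
qed

text \<open>\<open>spin_conj\<close> is a left inverse and the reversed negated product a right
  inverse of the same operator, hence they agree.\<close>

lemma spin_conj_op_prod:
  assumes "set ws \<subseteq> vector_sphere" "even (length ws)"
  shows "spin_conj (op_prod ws) = op_prod (map op_neg (rev ws))"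
proof -
  have "op_prod ws \<in> spin_group" using assms by (auto simp: spin_group_def)
  then have "spin_conj (op_prod ws) \<circ> op_prod ws = id" by (rule spin_conj_inverse)
  moreover have "op_prod ws \<circ> op_prod (map op_neg (rev ws)) = id"
    using op_prod_conj(2)[OF assms(1)] assms(2) by (simp add: fun_eq_iff)
  ultimately show ?thesis by (metis comp_assoc comp_id id_comp)
qed

text \<open>If \<eta> is the sum of the \<open>R\<^sub>l Y\<^sub>l\<close>, where
  \<open>Y\<^sub>l\<close> multiplies by a real linear form and so commutes with all
  \<open>R\<^sub>k\<close>, the inner product with \<open>R\<^sub>k\<close> leaves
  \<open>Y\<^sub>k\<close> alone, and composing with \<open>R\<^sub>k\<close> restores
  \<open>R\<^sub>k Y\<^sub>k\<close>.\<close>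

lemma var_component_power_series:
  assumes \<eta>: "\<And>a. \<eta> (power_series a) = power_series (\<lambda>\<beta>. \<Sum>k\<in>UNIV. gen (Inl k) * mul_lin (M $ k) a \<beta>)"
  shows "var_component \<eta> k (power_series a) = power_series (\<lambda>\<beta>. gen (Inl k) * mul_lin (M $ k) a \<beta>)"
proof -
  let ?g = "\<lambda>k. gen (Inl k :: 'a + 'a)"
  have m: "mul_lin w (\<lambda>\<beta>. c * a \<beta>) \<beta> = c * mul_lin w a \<beta>" for w and c :: "'a clifford" and a \<beta>
    by (auto simp: mul_lin_def mul_var_def sum_distrib_left intro!: sum.cong)
  \<comment> \<open>The two terms cancel by anticommutation when l and k differ and coincide when
    they are equal.\<close>
  have gg: "?g l * (?g k * (?g k * y)) + ?g k * (?g l * (?g k * y)) = (if l = k then 2 *\<^sub>R (?g k * y) else 0)" for l y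
  proof (cases "l = k")
    case False
    then have "?g l * (?g k * z) = - (?g k * (?g l * z))" for z
      using gen_anticommute[of "Inl l" "Inl k :: 'a + 'a"] by (simp flip: mult.assoc)
    then show ?thesis using False by simp
  qed (simp add: gen_square scaleR_2 flip: mult.assoc)
  have "(\<Sum>l\<in>UNIV. ?g l * (?g k * (?g k * mul_lin (M $ l) a \<beta>))) +
      ?g k * (\<Sum>l\<in>UNIV. ?g l * (?g k * mul_lin (M $ l) a \<beta>)) = 2 *\<^sub>R (?g k * mul_lin (M $ k) a \<beta>)" for \<beta>
    by (simp add: gg sum_distrib_left flip: sum.distrib)
  then show ?thesis
    by (simp add: var_component_def op_inner_def R_op_power_series \<eta> m power_series_add power_series_scaleR fun_eq_iff)
qed

text \<open>Linear forms and generators commute, so the monomial separates into a real series and a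
  constant: the former is the monomial in M X, the latter the blade.\<close>

lemma var_monomial_power_series:
  assumes \<eta>: "\<And>k a. \<eta> k (power_series a) = power_series (\<lambda>\<beta>. gen (Inl k) * mul_lin (M $ k) a \<beta>)"
  shows "var_monomial \<eta> \<alpha> = power_series (\<lambda>\<beta>. subst_coeff M \<alpha> \<beta> *\<^sub>R blade \<alpha>)"
proof -
  let ?g = "\<lambda>k. gen (Inl k :: 'a + 'a)"
  let ?F = "\<lambda>l. foldr (\<lambda>k. mul_lin (M $ k) ^^ (\<alpha> $ k)) l (\<lambda>\<beta>. if \<beta> = 0 then 1 else 0 :: real)"
  have m: "mul_lin w (\<lambda>\<beta>. a \<beta> *\<^sub>R c) \<beta> = mul_lin w a \<beta> *\<^sub>R c" for w and c :: "'a clifford" and a \<beta>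
    by (auto simp: mul_lin_def mul_var_def scaleR_sum_left intro!: sum.cong)
  have p: "(\<eta> k ^^ n) (power_series (\<lambda>\<beta>. a \<beta> *\<^sub>R c)) =
      power_series (\<lambda>\<beta>. (mul_lin (M $ k) ^^ n) a \<beta> *\<^sub>R (?g k ^ n * c))" for k n a c
    by (induction n) (simp_all add: \<eta> m mult.assoc)
  have "foldr (\<lambda>k. \<eta> k ^^ (\<alpha> $ k)) l (\<lambda>x. 1) =
      power_series (\<lambda>\<beta>. ?F l \<beta> *\<^sub>R prod_list (map (\<lambda>k. ?g k ^ (\<alpha> $ k)) l))" for l
  proof (induction l)
    case Nil
    have "(\<lambda>\<beta>. (if \<beta> = 0 then 1 else 0) *\<^sub>R 1) = (\<lambda>\<beta> :: 'a multi. if \<beta> = 0 then 1 else 0 :: 'a clifford)" by auto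
    then show ?case by (simp add: power_series_one)
  next
    case (Cons k l)
    then show ?case by (simp add: p)
  qed
  then show ?thesis by (simp add: var_monomial_def subst_coeff_def blade_def)
qed

text \<open>The blade of the substituted monomial cancels the \<open>rev_blade\<close> in the Taylor
  coefficient, which leaves the plain substitution in the series.\<close>

lemma substitute_power_series:
  assumes "\<And>\<alpha>. var_monomial (var_component \<eta>) \<alpha> = power_series (\<lambda>\<beta>. subst_coeff M \<alpha> \<beta> *\<^sub>R blade \<alpha>)"
  shows "substitute \<eta> (power_series a) = power_series (linear_subst M a)"
proof
  fix x :: "int ^ 'a::{finite,linorder}"
  obtain N where N: "\<forall>i. 2 * nat \<bar>x $ i\<bar> \<le> N" by (rule ex_lattice_bound[of x])
  define S where "S = {\<alpha> :: 'a multi. \<forall>i. \<alpha> $ i \<le> N}"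
  \<comment> \<open>Only \<beta> in the box \<open>S\<close> matter at x, and by homogeneity only
    \<alpha> sharing a degree with some such \<beta>; so \<open>T\<close> is finite and the two sums
    can be interchanged.\<close>
  define T where "T = (\<Union>\<beta>\<in>S. {\<alpha> :: 'a multi. multi_degree \<alpha> = multi_degree \<beta>})"
  have S: "finite S" unfolding S_def by (rule finite_multi_le)
  then have T: "finite T" unfolding T_def using finite_multi_degree by blast
  let ?t = "\<lambda>\<alpha> \<beta>. basic_poly \<beta> x * (rev_blade \<beta> * (subst_coeff M \<alpha> \<beta> *\<^sub>R a \<alpha>))"
  have "power_series (\<lambda>\<beta>. subst_coeff M \<alpha> \<beta> *\<^sub>R blade \<alpha>) x * (rev_blade \<alpha> * a \<alpha>) = (\<Sum>\<beta>\<in>S. ?t \<alpha> \<beta>)" for \<alpha>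
  proof -
    have "blade \<alpha> * (rev_blade \<alpha> * a \<alpha>) = a \<alpha>" by (simp add: blade_rev_blade flip: mult.assoc)
    then show ?thesis
      unfolding power_series_mult_right unfolding power_series_eq[OF N] S_def by (simp add: mult.assoc)
  qed
  then have "substitute \<eta> (power_series a) x = Sum_any (\<lambda>\<alpha>. \<Sum>\<beta>\<in>S. ?t \<alpha> \<beta>)"
    unfolding substitute_def termwise_def assms taylor_coeff_power_series by simp
  also have "\<dots> = (\<Sum>\<alpha>\<in>T. \<Sum>\<beta>\<in>S. ?t \<alpha> \<beta>)"
  proof (rule Sum_any.expand_superset[OF T], rule subsetI, rule ccontr)
    fix \<alpha> assume "\<alpha> \<in> {\<alpha>. (\<Sum>\<beta>\<in>S. ?t \<alpha> \<beta>) \<noteq> 0}" "\<alpha> \<notin> T"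
    moreover from this have "(\<Sum>\<beta>\<in>S. ?t \<alpha> \<beta>) = 0"
      using subst_coeff_eq_0[of \<alpha> _ M] by (intro sum.neutral) (auto simp: T_def)
    ultimately show False by simp
  qed
  also have "\<dots> = (\<Sum>\<beta>\<in>S. \<Sum>\<alpha>\<in>T. ?t \<alpha> \<beta>)" by (rule sum.swap)
  also have "\<dots> = (\<Sum>\<beta>\<in>S. basic_poly \<beta> x * (rev_blade \<beta> * linear_subst M a \<beta>))"
  proof (rule sum.cong[OF refl])
    fix \<beta> assume \<beta>: "\<beta> \<in> S"
    have "linear_subst M a \<beta> = (\<Sum>\<alpha>\<in>T. subst_coeff M \<alpha> \<beta> *\<^sub>R a \<alpha>)"
      unfolding linear_subst_def
      by (rule sum.mono_neutral_left[OF T]) (use \<beta> subst_coeff_eq_0[of _ \<beta> M] in \<open>auto simp: T_def\<close>)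
    then show "(\<Sum>\<alpha>\<in>T. ?t \<alpha> \<beta>) = basic_poly \<beta> x * (rev_blade \<beta> * linear_subst M a \<beta>)"
      by (simp add: sum_distrib_left)
  qed
  also have "\<dots> = power_series (linear_subst M a) x"
    unfolding S_def by (rule power_series_eq[OF N, symmetric])
  finally show "substitute \<eta> (power_series a) x = power_series (linear_subst M a) x" .
qed

lemma rotated_xi_power_series:
  fixes L :: "real ^ 'm::{finite,linorder} \<Rightarrow> real ^ 'm::{finite,linorder}"
  assumes t: "\<And>a. t (power_series a) = power_series (\<lambda>\<beta>. u' * a \<beta>)"
    and s: "\<And>a. s (power_series a) = power_series (\<lambda>\<beta>. u * a \<beta>)"
    and L: "\<And>v. u' * clifford_vec v * u = clifford_vec (L v)"
  shows "(t \<circ> xi \<circ> s) (power_series a) =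
    power_series (\<lambda>\<beta>. \<Sum>k\<in>UNIV. gen (Inl k) * mul_lin (matrix L $ k) a \<beta>)"
proof -
  have m: "mul_var j (\<lambda>\<beta>. u * a \<beta>) \<beta> = u * mul_var j a \<beta>" for j \<beta>
    by (simp add: mul_var_def)
  have g: "gen (Inl j) = clifford_vec (axis j 1)" for j :: 'm
  proof -
    have "clifford_vec (axis j 1) = (\<Sum>k\<in>UNIV. if k = j then gen (Inl k) else 0)"
      unfolding clifford_vec_def by (intro sum.cong) (auto simp: axis_def)
    then show ?thesis by simp
  qed
  have "u' * (\<Sum>j\<in>UNIV. gen (Inl j) * (u * mul_var j a \<beta>)) =
      (\<Sum>k\<in>UNIV. gen (Inl k) * mul_lin (matrix L $ k) a \<beta>)" for \<beta>
  proof -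
    have "u' * (\<Sum>j\<in>UNIV. gen (Inl j) * (u * mul_var j a \<beta>)) =
        (\<Sum>j\<in>UNIV. (u' * clifford_vec (axis j 1) * u) * mul_var j a \<beta>)"
      by (simp add: sum_distrib_left mult.assoc flip: g)
    also have "\<dots> = (\<Sum>j\<in>UNIV. \<Sum>k\<in>UNIV. (L (axis j 1) $ k) *\<^sub>R (gen (Inl k) * mul_var j a \<beta>))"
      unfolding L by (simp add: clifford_vec_def sum_distrib_right)
    \<comment> \<open>Column j of \<open>matrix L\<close> holds the coordinates of the image of the
      j-th unit vector; collecting the terms with \<open>gen (Inl k)\<close> therefore reads off row
      k.\<close>
    also have "\<dots> = (\<Sum>k\<in>UNIV. gen (Inl k) * mul_lin (matrix L $ k) a \<beta>)"
      by (subst sum.swap) (simp add: mul_lin_def matrix_def sum_distrib_left)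
    finally show ?thesis .
  qed
  then show ?thesis
    by (simp add: s xi_def xi_op_power_series power_series_sum m t)
qed

theorem theorem1:
  fixes s :: "'m::{finite,linorder} operator" and f :: "'m dfun"
  assumes "s \<in> spin_group"
    and "discrete_harmonic f"
  shows "discrete_harmonic (H1 s f) \<and> discrete_harmonic (H0 s f)"
proof -
  obtain ws where ws: "s = op_prod ws" "set ws \<subseteq> vector_sphere" "even (length ws)"
    using assms(1) by (auto simp: spin_group_def)
  obtain u u' L where s: "\<And>a. s (power_series a) = power_series (\<lambda>\<beta>. u * a \<beta>)"
    and t: "\<And>a. spin_conj s (power_series a) = power_series (\<lambda>\<beta>. u' * a \<beta>)"
    and L: "orthogonal_transformation L" "\<And>v. u' * clifford_vec v * u = clifford_vec (L v)"
    using op_prod_power_series[OF ws(2)] spin_conj_op_prod[OF ws(2,3)] unfolding ws(1) by metis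
  define a where "a = (\<lambda>\<alpha>. blade \<alpha> * taylor_coeff f \<alpha>)"
  have f: "f = power_series a" unfolding a_def by (rule power_series_blade[symmetric])
  let ?b = "linear_subst (matrix L) a"
  have H0: "H0 s f = power_series ?b"
    unfolding f H0_def
    by (intro substitute_power_series var_monomial_power_series var_component_power_series
        rotated_xi_power_series[OF t s L(2)])
  \<comment> \<open>The representation \<open>H1\<close> only adds a constant factor on each side of
    the coefficients.\<close>
  have H1: "H1 s f = power_series (\<lambda>\<beta>. u * ?b \<beta> * spin_conj s (\<lambda>x. 1) 0)"
    by (rule ext) (simp add: H1_def H0 s power_series_mult_right)
  have "orthogonal_matrix (matrix L)" using L(1) by (simp add: orthogonal_transformation_matrix)
  moreover have "(\<Sum>j\<in>UNIV. formal_deriv j (formal_deriv j a) \<beta>) = 0" for \<beta>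
    using assms(2) unfolding f discrete_harmonic_power_series by blast
  ultimately have b: "(\<Sum>j\<in>UNIV. formal_deriv j (formal_deriv j ?b) \<beta>) = 0" for \<beta>
    by (rule laplacian_linear_subst)
  \<comment> \<open>Formal derivatives have real factors and so commute with constant Clifford
    factors on either side.\<close>
  have "(\<Sum>j\<in>UNIV. formal_deriv j (formal_deriv j (\<lambda>\<beta>. u * ?b \<beta> * c)) \<beta>) =
      u * (\<Sum>j\<in>UNIV. formal_deriv j (formal_deriv j ?b) \<beta>) * c" for c \<beta>
    by (simp add: formal_deriv_def sum_distrib_left sum_distrib_right)
  then show ?thesis
    unfolding H0 H1 discrete_harmonic_power_series by (simp add: b)
qed

end
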